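(* Consider an allocation problem with $n$ agents and item set $\mathcal{M}$, and let $X=(X_1,\dots,X_n)$ be a Nash welfare maximizing allocation of $\mathcal{M}$, i.e. $\mathrm{NW}(X)=\mathrm{opt}(\mathcal{M})$. Given $X$, Algorithm 1 computes in polynomial time an allocation $Y=(Y_1,\dots,Y_n)$ of $\bigcup_{i=1}^n Y_i$ that is $2^{1-\frac1n}$-efficient (i.e. $2^{1-\frac1n}\cdot\mathrm{NW}(Y)\ge\mathrm{opt}(\mathcal{M})$), EFX and Pareto-optimal, and such that $Y_i\subseteq X_i$ for every agent $i$.
   Context: Allocation problem: agents $[n]=\{1,\dots,n\}$, a finite set $\mathcal{M}$ of $m$ indivisible items, valuations $v_i:\mathcal{M}\to\mathbb{R}_+$ (positive reals), extended additively: $v_i(S)=\sum_{g\in S}v_i(g)$. An allocation of $S\subseteq\mathcal{M}$ is an ordered partition $X=(X_1,\dots,X_n)$ of $S$ into $n$ pairwise disjoint (possibly empty) bundles; agent $i$ gets $X_i$. $X$ is EFX if $v_i(X_i)\ge\max_{g\in X_j}v_i(X_j\setminus\{g\})$ for all $i,j\in[n]$ (a maximum over an empty bundle is $0$). $\mathrm{NW}(X)=\left(\prod_{i}v_i(X_i)\right)^{1/n}$; $\mathrm{opt}(S)$ is the maximum of $\mathrm{NW}$ over allocations of $S$. An allocation $Y$ of $S\subseteq\mathcal{M}$ is $\alpha$-efficient if $\alpha\cdot\mathrm{NW}(Y)\ge\mathrm{opt}(\mathcal{M})$. An allocation of $S$ is Pareto-optimal if no other allocation of $S$ gives every agent at least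 as high a value and some agent a strictly higher value. Algorithm 1. Input: an allocation $X$ of $\mathcal{M}$ with $\mathrm{NW}(X)=\mathrm{opt}(\mathcal{M})$. Maintain an indexed family of bundles $Z=(Z_1,\dots,Z_n)$, initially $Z=X$. A bundle $Z_j$ is called touched if at least one item has been removed from it. The EFX feasibility graph of $Z$ is the bipartite graph $G$ with vertex parts $[n]$ (agents) and $\{Z_1,\dots,Z_n\}$ (bundles, as $n$ distinct vertices), with an edge $(i,Z_j)$ if and only if (i) $Z_j$ is EFX feasible for $i$, i.e. $v_i(Z_j)\ge\max_{g\in Z_k}v_i(Z_k\setminus\{g\})$ for all $k\in[n]$, and (ii) if $i\ne j$ then $v_i(Z_j)>v_i(Z_i)$. The robust demand of agent $i$ is any bundle $Z_j$ maximizing $\max_{c\in Z_j}v_i(Z_j\setminus\{c\})$ over all bundles (ties broken arbitrarily). In each iteration: build $G$ for the current $Z$; let $T$ be the set of touched bundles; choose a matching $M$ in $G$ such that (a) all bundles in $T$ are matched, (b) subject to (a), $|M\cap\{(i,Z_i):i\in[n]\}|$ is maximum, (c) subject to (a) and (b), $|M|$ is maximum. If $|M|=n$, stop and return $Y$, where $Y_i$ is the bundle matched to agent $i$ in $M$. Otherwise pick an arbitrary agent $i$ not matched in $M$, let $Z_j$ be the robust demand of $i$, remove from $Z_j$ an item of minimum value for agent $i$ among the items of $Z_j$, and go to the next iteration.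
   Formalization: Pareto-optimality of Y is claimed only when opt(M) > 0 (equivalently, at least as many items as agents); for opt(M) = 0 it can fail, e.g. three agents, two items a, b, X = ({a},{b},∅), where agents 1 and 2 each prefer the other's item. *)

theory Defs
  imports
    Complex_Main
    "HOL-Library.Disjoint_Sets"
    "HOL-Computational_Algebra.Polynomial"
begin

section \<open>Allocations\<close>

text \<open>
  The agents are \<open>0, \<dots>, n - 1\<close>.  A family of bundles is a function on agents, of which only the
  values at \<open>i < n\<close> matter; likewise \<open>v i g\<close> matters only for \<open>i < n\<close> and \<open>g\<close> in the item set.
\<close>

definition val :: "(nat \<Rightarrow> 'a \<Rightarrow> real) \<Rightarrow> nat \<Rightarrow> 'a set \<Rightarrow> real" where
  "val v i S = (\<Sum>g\<in>S. v i g)"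

definition allocation :: "nat \<Rightarrow> 'a set \<Rightarrow> (nat \<Rightarrow> 'a set) \<Rightarrow> bool" where
  "allocation n S X \<longleftrightarrow> disjoint_family_on X {..<n} \<and> (\<Union>i<n. X i) = S"

definition NW :: "nat \<Rightarrow> (nat \<Rightarrow> 'a \<Rightarrow> real) \<Rightarrow> (nat \<Rightarrow> 'a set) \<Rightarrow> real" where
  "NW n v X = root n (\<Prod>i<n. val v i (X i))"

definition opt :: "nat \<Rightarrow> (nat \<Rightarrow> 'a \<Rightarrow> real) \<Rightarrow> 'a set \<Rightarrow> real" where
  "opt n v S = Max {NW n v X | X. allocation n S X}"

definition max_minus_one :: "(nat \<Rightarrow> 'a \<Rightarrow> real) \<Rightarrow> nat \<Rightarrow> 'a set \<Rightarrow> real" where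
  "max_minus_one v i B = (if B = {} then 0 else Max ((\<lambda>g. val v i (B - {g})) ` B))"

definition EFX :: "nat \<Rightarrow> (nat \<Rightarrow> 'a \<Rightarrow> real) \<Rightarrow> (nat \<Rightarrow> 'a set) \<Rightarrow> bool" where
  "EFX n v X \<longleftrightarrow> (\<forall>i<n. \<forall>j<n. val v i (X i) \<ge> max_minus_one v i (X j))"

definition efficient ::
  "nat \<Rightarrow> (nat \<Rightarrow> 'a \<Rightarrow> real) \<Rightarrow> 'a set \<Rightarrow> real \<Rightarrow> (nat \<Rightarrow> 'a set) \<Rightarrow> bool" where
  "efficient n v \<M> \<alpha> Y \<longleftrightarrow> (\<exists>S\<subseteq>\<M>. allocation n S Y) \<and> \<alpha> * NW n v Y \<ge> opt n v \<M>"

definition pareto_optimal ::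
  "nat \<Rightarrow> (nat \<Rightarrow> 'a \<Rightarrow> real) \<Rightarrow> 'a set \<Rightarrow> (nat \<Rightarrow> 'a set) \<Rightarrow> bool" where
  "pareto_optimal n v S Y \<longleftrightarrow> allocation n S Y \<and>
     \<not> (\<exists>W. allocation n S W \<and> (\<forall>i<n. val v i (W i) \<ge> val v i (Y i)) \<and>
            (\<exists>i<n. val v i (W i) > val v i (Y i)))"


section \<open>The algorithm\<close>

text \<open>
  The bundle with index \<open>j\<close> is the vertex \<open>j\<close> of the second part, so that an edge
  joining agent \<open>i\<close> to bundle \<open>Z j\<close> is the pair \<open>(i, j)\<close>, and the \<open>n\<close> bundle vertices are distinct
  even if some bundles are equal as sets.
\<close>

definition efx_feasible ::
  "nat \<Rightarrow> (nat \<Rightarrow> 'a \<Rightarrow> real) \<Rightarrow> (nat \<Rightarrow> 'a set) \<Rightarrow> nat \<Rightarrow> nat \<Rightarrow> bool" where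
  "efx_feasible n v Z i j \<longleftrightarrow> (\<forall>k<n. val v i (Z j) \<ge> max_minus_one v i (Z k))"

definition feasibility_graph ::
  "nat \<Rightarrow> (nat \<Rightarrow> 'a \<Rightarrow> real) \<Rightarrow> (nat \<Rightarrow> 'a set) \<Rightarrow> (nat \<times> nat) set" where
  "feasibility_graph n v Z = {(i, j). i < n \<and> j < n \<and> efx_feasible n v Z i j \<and>
     (i \<noteq> j \<longrightarrow> val v i (Z j) > val v i (Z i))}"

definition touched :: "nat \<Rightarrow> (nat \<Rightarrow> 'a set) \<Rightarrow> (nat \<Rightarrow> 'a set) \<Rightarrow> nat set" where
  "touched n X Z = {j. j < n \<and> (\<exists>g\<in>X j. g \<notin> Z j)}"

definition matching :: "(nat \<times> nat) set \<Rightarrow> (nat \<times> nat) set \<Rightarrow> bool" where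
  "matching G M \<longleftrightarrow> M \<subseteq> G \<and> inj_on fst M \<and> inj_on snd M"

definition matching_a :: "(nat \<times> nat) set \<Rightarrow> nat set \<Rightarrow> (nat \<times> nat) set \<Rightarrow> bool" where
  "matching_a G T M \<longleftrightarrow> matching G M \<and> T \<subseteq> snd ` M"

definition matching_b :: "(nat \<times> nat) set \<Rightarrow> nat set \<Rightarrow> (nat \<times> nat) set \<Rightarrow> bool" where
  "matching_b G T M \<longleftrightarrow> matching_a G T M \<and>
     (\<forall>M'. matching_a G T M' \<longrightarrow> card (M' \<inter> Id) \<le> card (M \<inter> Id))"

definition matching_c :: "(nat \<times> nat) set \<Rightarrow> nat set \<Rightarrow> (nat \<times> nat) set \<Rightarrow> bool" where
  "matching_c G T M \<longleftrightarrow> matching_b G T M \<and> (\<forall>M'. matching_b G T M' \<longrightarrow> card M' \<le> card M)"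

definition selectable ::
  "nat \<Rightarrow> (nat \<Rightarrow> 'a \<Rightarrow> real) \<Rightarrow> (nat \<Rightarrow> 'a set) \<Rightarrow> (nat \<Rightarrow> 'a set) \<Rightarrow> (nat \<times> nat) set \<Rightarrow> bool" where
  "selectable n v X Z M \<longleftrightarrow> matching_c (feasibility_graph n v Z) (touched n X Z) M"

definition robust_demand ::
  "nat \<Rightarrow> (nat \<Rightarrow> 'a \<Rightarrow> real) \<Rightarrow> (nat \<Rightarrow> 'a set) \<Rightarrow> nat \<Rightarrow> nat \<Rightarrow> bool" where
  "robust_demand n v Z i j \<longleftrightarrow>
     j < n \<and> (\<forall>k<n. max_minus_one v i (Z k) \<le> max_minus_one v i (Z j))"

text \<open>
  Every choice the algorithm leaves open (matching, unmatched agent, robust demand, item of minimum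
  value) is nondeterministic.  \<open>X\<close> is the input, \<open>Z\<close> the current family of bundles.
\<close>

definition alg_choice ::
  "nat \<Rightarrow> (nat \<Rightarrow> 'a \<Rightarrow> real) \<Rightarrow> (nat \<Rightarrow> 'a set) \<Rightarrow> (nat \<Rightarrow> 'a set) \<Rightarrow> nat \<Rightarrow> nat \<Rightarrow> bool" where
  "alg_choice n v X Z i j \<longleftrightarrow>
     (\<exists>M. selectable n v X Z M \<and> card M \<noteq> n \<and> i < n \<and> i \<notin> fst ` M \<and> robust_demand n v Z i j)"

definition alg_step ::
  "nat \<Rightarrow> (nat \<Rightarrow> 'a \<Rightarrow> real) \<Rightarrow> (nat \<Rightarrow> 'a set) \<Rightarrow> (nat \<Rightarrow> 'a set) \<Rightarrow> (nat \<Rightarrow> 'a set) \<Rightarrow> bool" where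
  "alg_step n v X Z Z' \<longleftrightarrow>
     (\<exists>i j c. alg_choice n v X Z i j \<and> c \<in> Z j \<and> (\<forall>d\<in>Z j. v i c \<le> v i d) \<and>
              Z' = Z(j := Z j - {c}))"

definition alg_output ::
  "nat \<Rightarrow> (nat \<Rightarrow> 'a \<Rightarrow> real) \<Rightarrow> (nat \<Rightarrow> 'a set) \<Rightarrow> (nat \<Rightarrow> 'a set) \<Rightarrow> bool" where
  "alg_output n v X Y \<longleftrightarrow>
     (\<exists>Z M. (alg_step n v X)\<^sup>*\<^sup>* X Z \<and> selectable n v X Z M \<and> card M = n \<and>
            (\<forall>(i, j)\<in>M. Y i = Z j))"

text \<open>
  The next iteration can be carried out whatever choices are made: a matching as required exists,
  and a bundle from which an item has to be removed is nonempty.  The other choices are always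
  possible (there is an unmatched agent when the matching has fewer than \<open>n\<close> edges, and
  a robust demand exists for \<open>n > 0\<close>).
\<close>

definition alg_not_stuck ::
  "nat \<Rightarrow> (nat \<Rightarrow> 'a \<Rightarrow> real) \<Rightarrow> (nat \<Rightarrow> 'a set) \<Rightarrow> (nat \<Rightarrow> 'a set) \<Rightarrow> bool" where
  "alg_not_stuck n v X Z \<longleftrightarrow>
     (\<exists>M. selectable n v X Z M) \<and> (\<forall>i j. alg_choice n v X Z i j \<longrightarrow> Z j \<noteq> {})"


section \<open>Model of computation\<close>

text \<open>
  Running time is measured for programs of a small imperative language over natural numbers and real
  numbers.  Each assignment and each test costs one unit; the expressions in them are fixed by the
  program, so they contribute a constant factor only.  The only arithmetic operations
  are addition and subtraction: with unit-cost multiplication, numbers with exponentially many digits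
  could be produced in polynomial time.  Reals can be added, subtracted and compared, but not
  rounded or otherwise converted to natural numbers.

  A variable has a list of indices, which is empty for a scalar; the number of indices
  at each occurrence is fixed by the program.
\<close>

datatype nexp =
    NConst nat
  | NVar string "nexp list"
  | NAdd nexp nexp
  | NSub nexp nexp

datatype rexp =
    RZero
  | RVar string "nexp list"
  | RAdd rexp rexp
  | RSub rexp rexp

datatype bexp =
    NLess nexp nexp
  | RLess rexp rexp
  | BNot bexp
  | BAnd bexp bexp

datatype com =
    Skip
  | NAssign string "nexp list" nexp
  | RAssign string "nexp list" rexp
  | Seq com com
  | Cond bexp com com
  | While bexp com

type_synonym nstore = "string \<Rightarrow> nat list \<Rightarrow> nat"
type_synonym rstore = "string \<Rightarrow> nat list \<Rightarrow> real"
type_synonym state = "nstore \<times> rstore"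

primrec nval :: "nstore \<Rightarrow> nexp \<Rightarrow> nat" where
  "nval N (NConst k) = k"
| "nval N (NVar x es) = N x (map (nval N) es)"
| "nval N (NAdd a b) = nval N a + nval N b"
| "nval N (NSub a b) = nval N a - nval N b"

primrec rval :: "state \<Rightarrow> rexp \<Rightarrow> real" where
  "rval s RZero = 0"
| "rval s (RVar x es) = snd s x (map (nval (fst s)) es)"
| "rval s (RAdd a b) = rval s a + rval s b"
| "rval s (RSub a b) = rval s a - rval s b"

primrec bval :: "state \<Rightarrow> bexp \<Rightarrow> bool" where
  "bval s (NLess a b) \<longleftrightarrow> nval (fst s) a < nval (fst s) b"
| "bval s (RLess a b) \<longleftrightarrow> rval s a < rval s b"
| "bval s (BNot b) \<longleftrightarrow> \<not> bval s b"
| "bval s (BAnd a b) \<longleftrightarrow> bval s a \<and> bval s b"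

definition nupdate :: "string \<Rightarrow> nexp list \<Rightarrow> nexp \<Rightarrow> state \<Rightarrow> state" where
  "nupdate x es a s =
     ((fst s)(x := (fst s x)(map (nval (fst s)) es := nval (fst s) a)), snd s)"

definition rupdate :: "string \<Rightarrow> nexp list \<Rightarrow> rexp \<Rightarrow> state \<Rightarrow> state" where
  "rupdate x es a s =
     (fst s, (snd s)(x := (snd s x)(map (nval (fst s)) es := rval s a)))"

text \<open>\<open>exec c s t s'\<close>: started in state \<open>s\<close>, program \<open>c\<close> halts in state \<open>s'\<close> at total cost \<open>t\<close>.\<close>

inductive exec :: "com \<Rightarrow> state \<Rightarrow> nat \<Rightarrow> state \<Rightarrow> bool" where
  Skip: "exec Skip s 1 s"
| NAssign: "exec (NAssign x es a) s 1 (nupdate x es a s)"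
| RAssign: "exec (RAssign x es a) s 1 (rupdate x es a s)"
| Seq: "exec c s t s' \<Longrightarrow> exec d s' u s'' \<Longrightarrow> exec (Seq c d) s (t + u) s''"
| CondTrue: "bval s b \<Longrightarrow> exec c s t s' \<Longrightarrow> exec (Cond b c d) s (1 + t) s'"
| CondFalse: "\<not> bval s b \<Longrightarrow> exec d s t s' \<Longrightarrow> exec (Cond b c d) s (1 + t) s'"
| WhileFalse: "\<not> bval s b \<Longrightarrow> exec (While b c) s 1 s"
| WhileTrue: "bval s b \<Longrightarrow> exec c s t s' \<Longrightarrow> exec (While b c) s' u s'' \<Longrightarrow>
    exec (While b c) s (1 + t + u) s''"

inductive_cases exec_elims:
  "exec Skip s t s'"
  "exec (NAssign x es a) s t s'"
  "exec (RAssign x es a) s t s'"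
  "exec (Seq c d) s t s'"
  "exec (Cond b c d) s t s'"
  "exec (While b c) s t s'"

lemma exec_deterministic:
  assumes "exec c s t s'" and "exec c s u s''"
  shows "u = t \<and> s'' = s'"
  using assms
proof (induction arbitrary: u s'' rule: exec.induct)
  case (Seq c s t s1 d t' s2)
  from Seq.prems obtain u1 u2 r where
    r: "exec c s u1 r" "exec d r u2 s''" "u = u1 + u2" by (elim exec_elims(4)) auto
  from Seq.IH(1)[OF r(1)] have "u1 = t" "r = s1" by simp_all
  with Seq.IH(2)[of u2 s''] r show ?case by simp
next
  case (CondTrue s b c t s' d)
  from CondTrue.prems CondTrue.hyps(1) obtain u1 where
    r: "exec c s u1 s''" "u = 1 + u1" by (elim exec_elims(5)) auto
  from CondTrue.IH[OF r(1)] r(2) show ?case by simp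
next
  case (CondFalse s b d t s' c)
  from CondFalse.prems CondFalse.hyps(1) obtain u1 where
    r: "exec d s u1 s''" "u = 1 + u1" by (elim exec_elims(5)) auto
  from CondFalse.IH[OF r(1)] r(2) show ?case by simp
next
  case (WhileTrue s b c t s1 t' s2)
  from WhileTrue.prems WhileTrue.hyps(1) obtain u1 u2 r where
    r: "exec c s u1 r" "exec (While b c) r u2 s''" "u = 1 + u1 + u2"
    by (cases rule: exec_elims(6)) auto
  from WhileTrue.IH(1)[OF r(1)] have "u1 = t" "r = s1" by simp_all
  with WhileTrue.IH(2)[of u2 s''] r show ?case by simp
next
  case (WhileFalse s b c)
  from WhileFalse.prems WhileFalse.hyps show ?case by (cases rule: exec_elims(6)) auto
qed (auto elim!: exec_elims(1-3))

text \<open>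
  The list \<open>gs\<close> enumerates the items; inside the machine an item is its position in \<open>gs\<close>.  The input
  consists of the scalars \<open>n\<close> and \<open>m\<close>, the matrix \<open>v\<close> of values and the 0-1 incidence matrix
  \<open>x\<close> of the allocation; all other memory cells are zero.  The output is read off the matrix \<open>y\<close>,
  where item \<open>g\<close> belongs to agent \<open>i\<close> if the entry \<open>(i, g)\<close> is nonzero.
\<close>

definition input_state ::
  "nat \<Rightarrow> (nat \<Rightarrow> 'a \<Rightarrow> real) \<Rightarrow> (nat \<Rightarrow> 'a set) \<Rightarrow> 'a list \<Rightarrow> state" where
  "input_state n v X gs =
     ((\<lambda>a is.
         if a = ''n'' \<and> is = [] then n
         else if a = ''m'' \<and> is = [] then length gs
         else case is of
           [i, g] \<Rightarrow> if a = ''x'' \<and> i < n \<and> g < length gs then of_bool (gs ! g \<in> X i) else 0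
         | _ \<Rightarrow> 0),
      (\<lambda>a is.
         case is of
           [i, g] \<Rightarrow> if a = ''v'' \<and> i < n \<and> g < length gs then v i (gs ! g) else 0
         | _ \<Rightarrow> 0))"

definition output_family :: "'a list \<Rightarrow> state \<Rightarrow> nat \<Rightarrow> 'a set" where
  "output_family gs s i = {gs ! g | g. g < length gs \<and> fst s ''y'' [i, g] \<noteq> 0}"

end

theory Submission
  imports Defs
begin

text \<open>
  Correctness.  An agent \<open>i\<close> missed by the chosen matching cannot find its own bundle EFX feasible, so
  once its robust demand has lost the item, it can be matched to it; hence the touched bundles always
  remain matchable.  An edge off the diagonal is a strict improvement for its agent, and whatever has
  been removed from \<open>X i\<close> can be handed back to \<open>i\<close>, so rotating bundles along a cycle of edges would
  improve the optimal allocation \<open>X\<close>.  Therefore a perfect matching is the identity; a variant of the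
  exchange shows that no bundle ever loses more than half of its value to its original owner and that
  some bundle stays untouched, which gives the factor \<open>2 powr (1 - 1 / n)\<close>.  If the optimum is 0, then some bundle is empty, so a perfect
  matching can only occur when all bundles have at most one item, and it is the identity again.

  Running time.  The three criteria for the matching are combined into polynomially bounded integer
  weights, and a maximum-weight matching is found by an auction in the manner of Bertsekas.  Its prices
  are integers that grow by 1 with each bid and stay bounded by the weights, so no arithmetic beyond
  addition and subtraction is needed.
\<close>

section \<open>Allocations and the loop invariant\<close>

text \<open>Pareto optimality is claimed only for a positive optimum, and it can fail otherwise.
  With three agents and two items the optimum is 0, so \<open>X\<close> may give agents 0 and 1 one
  item each although each prefers the item of the other. Every agent finds its own bundle EFX
  feasible, the algorithm stops at once with \<open>X\<close>, and swapping the two items improves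
  both agents. Two facts simplify the program. All matchings meeting the three criteria have the
  same number of edges, so whether the algorithm stops does not depend on the choice among them. A
  perfect one is the identity, so the program never applies it and simply outputs the current
  family. The program is a fixed term, so one common bound \<open>H\<close> on the iterations of all
  its loops gives a cost polynomial in \<open>H\<close>. The auction dictates the size of
  \<open>H\<close>: the weights are at most \<open>K + K * K + K * (K * K)\<close> for
  \<open>K = n + 1\<close>, and each of the \<open>n\<close> prices exceeds them by at most
  1.\<close>

lemma val_mono:
  assumes "finite B" and "\<forall>g\<in>B. 0 \<le> v i g" and "A \<subseteq> B"
  shows "val v i A \<le> val v i B"
  unfolding val_def using assms by (intro sum_mono2) auto

lemma max_minus_one_ge:
  assumes "finite B" and "g \<in> B"
  shows "val v i (B - {g}) \<le> max_minus_one v i B"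
  using assms unfolding max_minus_one_def by (auto intro: Max_ge)

lemma max_minus_one_nonneg:
  assumes "finite B" and "\<forall>g\<in>B. 0 \<le> v i g"
  shows "0 \<le> max_minus_one v i B"
proof (cases "B = {}")
  case False
  then obtain g where g: "g \<in> B" by blast
  have "0 \<le> val v i (B - {g})"
    unfolding val_def using assms by (intro sum_nonneg) auto
  also have "\<dots> \<le> max_minus_one v i B"
    by (rule max_minus_one_ge) (use assms g in auto)
  finally show ?thesis .
qed (simp add: max_minus_one_def)

lemma max_minus_one_leI:
  assumes "finite B" and "0 \<le> a" and "\<And>g. g \<in> B \<Longrightarrow> val v i (B - {g}) \<le> a"
  shows "max_minus_one v i B \<le> a"
  using assms unfolding max_minus_one_def by auto

lemma max_minus_one_mono:
  assumes "finite B" and "\<forall>g\<in>B. 0 \<le> v i g" and "A \<subseteq> B"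
  shows "max_minus_one v i A \<le> max_minus_one v i B"
proof (rule max_minus_one_leI)
  show "finite A" using assms finite_subset by blast
  show "0 \<le> max_minus_one v i B" using assms by (intro max_minus_one_nonneg)
  fix g assume g: "g \<in> A"
  have "val v i (A - {g}) \<le> val v i (B - {g})"
    using assms by (intro val_mono) auto
  also have "\<dots> \<le> max_minus_one v i B"
    using assms g by (intro max_minus_one_ge) auto
  finally show "val v i (A - {g}) \<le> max_minus_one v i B" .
qed

text \<open>Dropping a cheapest item leaves the most. After a step of the algorithm the shrunken
  bundle is therefore worth exactly the old \<open>max_minus_one\<close> to the agent that chose
  it.\<close>

lemma max_minus_one_min:
  assumes "finite B" and "\<forall>g\<in>B. 0 \<le> v i g" and "c \<in> B" and "\<forall>d\<in>B. v i c \<le> v i d"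
  shows "max_minus_one v i B = val v i (B - {c})"
proof (rule antisym)
  show "max_minus_one v i B \<le> val v i (B - {c})"
  proof (rule max_minus_one_leI)
    show "0 \<le> val v i (B - {c})"
      unfolding val_def using assms by (intro sum_nonneg) auto
    fix g assume "g \<in> B"
    then show "val v i (B - {g}) \<le> val v i (B - {c})"
      using assms by (simp add: val_def sum_diff1)
  qed (use assms in auto)
  show "val v i (B - {c}) \<le> max_minus_one v i B"
    using assms by (intro max_minus_one_ge) auto
qed

lemma max_minus_one_le_val:
  assumes "finite B" and "\<forall>g\<in>B. 0 \<le> v i g"
  shows "max_minus_one v i B \<le> val v i B"
proof (rule max_minus_one_leI)
  show "0 \<le> val v i B" unfolding val_def using assms by (intro sum_nonneg) auto
  show "val v i (B - {g}) \<le> val v i B" for g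
    using assms by (intro val_mono) auto
qed (use assms in auto)

text \<open>Families are functions on all naturals, so there can be infinitely many allocations;
  restricting them to the agents leaves the welfare unchanged and makes them finite in number.
  Without this \<open>Max\<close> in \<open>opt\<close> would say nothing.\<close>

lemma finite_NW_values:
  assumes "finite S"
  shows "finite {NW n v X | X. allocation n S X}"
proof -
  have "{NW n v X | X. allocation n S X} \<subseteq> NW n v ` (PiE {..<n} (\<lambda>_. Pow S))"
  proof
    fix r assume "r \<in> {NW n v X | X. allocation n S X}"
    then obtain X where X: "r = NW n v X" "allocation n S X" by blast
    have "restrict X {..<n} \<in> PiE {..<n} (\<lambda>_. Pow S)"
      using X(2) by (auto simp: allocation_def)
    moreover have "NW n v (restrict X {..<n}) = r"
      unfolding X(1) NW_def by (intro arg_cong[where f = "root n"] prod.cong) auto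
    ultimately show "r \<in> NW n v ` (PiE {..<n} (\<lambda>_. Pow S))" by blast
  qed
  then show ?thesis
    by (rule finite_subset) (use assms in \<open>auto intro!: finite_imageI finite_PiE\<close>)
qed

text \<open>The removed items \<open>X i - Z i\<close> return to their owners on top of an arbitrary
  redistribution \<open>V\<close> of the remaining ones.\<close>

lemma allocation_union:
  assumes "allocation n S X" and "\<forall>i<n. Z i \<subseteq> X i" and "allocation n (\<Union>i<n. Z i) V"
  shows "allocation n S (\<lambda>i. (X i - Z i) \<union> V i)"
proof -
  have VZ: "x \<in> V i \<Longrightarrow> i < n \<Longrightarrow> \<exists>b<n. x \<in> Z b" for x i
    using assms(3) by (auto simp: allocation_def)
  have dX: "x \<in> X i \<Longrightarrow> x \<in> X j \<Longrightarrow> i < n \<Longrightarrow> j < n \<Longrightarrow> i = j" for x i j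
    using assms(1) by (auto simp: allocation_def disjoint_family_on_def)
  have "disjoint_family_on (\<lambda>i. (X i - Z i) \<union> V i) {..<n}"
    unfolding disjoint_family_on_def
  proof (intro ballI impI)
    fix i j assume ij: "i \<in> {..<n}" "j \<in> {..<n}" "i \<noteq> j"
    have "V i \<inter> V j = {}"
      using ij assms(3) by (auto simp: allocation_def disjoint_family_on_def)
    moreover have "(X i - Z i) \<inter> (X j - Z j) = {}" using ij dX by blast
    moreover have "(X a - Z a) \<inter> V b = {}" if "a < n" "b < n" for a b
      using that VZ[of _ b] dX assms(2) by blast
    ultimately show "(X i - Z i \<union> V i) \<inter> (X j - Z j \<union> V j) = {}"
      using ij by blast
  qed
  moreover have "(\<Union>i<n. (X i - Z i) \<union> V i) = S"
    using assms by (auto simp: allocation_def) blast+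
  ultimately show ?thesis by (simp add: allocation_def)
qed

text \<open>Here \<open>\<tau>\<close> names the new owner of each bundle. It need not be injective:
  an agent may collect several bundles or none.\<close>

lemma allocation_regroup:
  assumes "allocation n S Z" and "\<forall>b<n. \<tau> b < n"
  shows "allocation n S (\<lambda>a. \<Union>b\<in>{b. b < n \<and> \<tau> b = a}. Z b)"
proof -
  have dZ: "x \<in> Z b \<Longrightarrow> x \<in> Z c \<Longrightarrow> b < n \<Longrightarrow> c < n \<Longrightarrow> b = c" for x b c
    using assms(1) by (auto simp: allocation_def disjoint_family_on_def)
  have "(\<Union>a<n. \<Union>b\<in>{b. b < n \<and> \<tau> b = a}. Z b) = (\<Union>b<n. Z b)"
    using assms(2) by blast
  moreover have "disjoint_family_on (\<lambda>a. \<Union>b\<in>{b. b < n \<and> \<tau> b = a}. Z b) {..<n}"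
    unfolding disjoint_family_on_def using dZ by blast
  ultimately show ?thesis
    using assms(1) by (simp add: allocation_def)
qed

lemma allocation_subfamily:
  assumes "allocation n S X" and "\<forall>i<n. Z i \<subseteq> X i"
  shows "allocation n (\<Union>i<n. Z i) Z"
  using assms unfolding allocation_def disjoint_family_on_def by blast

lemma prod_less_single:
  fixes f g :: "'b \<Rightarrow> real"
  assumes "finite A" and "k \<in> A" and "\<And>a. a \<in> A \<Longrightarrow> 0 < f a"
    and "\<And>a. a \<in> A \<Longrightarrow> f a \<le> g a" and "f k < g k"
  shows "prod f A < prod g A"
proof -
  have "prod f A = f k * prod f (A - {k})" using assms by (simp add: prod.remove)
  also have "\<dots> < g k * prod f (A - {k})"
    using assms by (intro mult_strict_right_mono prod_pos) auto
  also have "\<dots> \<le> g k * prod g (A - {k})"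
    using assms(3)[OF assms(2)] assms(3,4,5)
    by (intro mult_left_mono prod_mono) (auto intro: less_imp_le)
  also have "\<dots> = prod g A" using assms by (simp add: prod.remove)
  finally show ?thesis .
qed

text \<open>The loss of less than a factor 2 at \<open>k\<close> is outweighed by the gain of more
  than a factor 2 at \<open>l\<close>. This trade-off is the source of the one-half bound on what a
  bundle may lose.\<close>

lemma prod_less_pair:
  fixes f g :: "'b \<Rightarrow> real"
  assumes "finite A" and "k \<in> A" and "l \<in> A" and "k \<noteq> l" and "\<And>a. a \<in> A \<Longrightarrow> 0 < f a"
    and "\<And>a. a \<in> A \<Longrightarrow> a \<noteq> k \<Longrightarrow> a \<noteq> l \<Longrightarrow> f a \<le> g a"
    and "f k < 2 * g k" and "2 * f l < g l"
  shows "prod f A < prod g A"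
proof -
  have pk: "0 < f k" "0 < f l" using assms by auto
  have P: "0 < prod f (A - {k} - {l})" using assms by (intro prod_pos) auto
  have "prod f A = (f k * f l) * prod f (A - {k} - {l})"
    using assms by (simp add: prod.remove mult.assoc)
  also have "\<dots> < (g k * g l) * prod f (A - {k} - {l})"
  proof (rule mult_strict_right_mono[OF _ P])
    have "f k * (2 * f l) < (2 * g k) * g l"
      using assms(7,8) pk by (intro mult_strict_mono) auto
    then show "f k * f l < g k * g l" by simp
  qed
  also have "\<dots> \<le> (g k * g l) * prod g (A - {k} - {l})"
    using assms(6-8) pk assms(5) by (intro mult_left_mono prod_mono) (auto intro: less_imp_le)
  also have "\<dots> = prod g A"
    using assms(1-4) by (simp add: prod.remove[of A k] prod.remove[of "A - {k}" l] mult.assoc)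
  finally show ?thesis .
qed

section \<open>Matchings in the feasibility graph\<close>

lemma feasibility_graph_subset: "feasibility_graph n v Z \<subseteq> {..<n} \<times> {..<n}"
  by (auto simp: feasibility_graph_def)

lemma matching_finite:
  assumes "matching (feasibility_graph n v Z) M"
  shows "finite M" and "card M \<le> n"
    and "card M = n \<Longrightarrow> fst ` M = {..<n}" and "card M = n \<Longrightarrow> snd ` M = {..<n}"
proof -
  have sub: "M \<subseteq> {..<n} \<times> {..<n}"
    using assms feasibility_graph_subset[of n v Z] by (auto simp: matching_def)
  then show "finite M" by (rule finite_subset) simp
  have c: "card (fst ` M) = card M" "card (snd ` M) = card M"
    using assms by (auto simp: matching_def card_image)
  have s: "fst ` M \<subseteq> {..<n}" "snd ` M \<subseteq> {..<n}" using sub by auto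
  show "card M \<le> n" using card_mono[OF _ s(1)] c by simp
  show "card M = n \<Longrightarrow> fst ` M = {..<n}" using s(1) c by (intro card_subset_eq) auto
  show "card M = n \<Longrightarrow> snd ` M = {..<n}" using s(2) c by (intro card_subset_eq) auto
qed

text \<open>Makes the stopping test independent of the matching selected.\<close>

lemma matching_c_card_eq:
  assumes "matching_c G T M" and "matching_c G T M'"
  shows "card M = card M'"
  using assms unfolding matching_c_def by (meson antisym)

text \<open>An exchange argument: adding \<open>(i, i)\<close> and dropping the edge at bundle
  \<open>i\<close>, if any, keeps every covered bundle covered. The dropped edge is not a loop
  because agent \<open>i\<close> is unmatched, so the number of loops would grow, against criterion
  (b).\<close>

lemma unmatched_not_loop:
  assumes "matching_b G T M" and "finite M" and "i \<notin> fst ` M"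
  shows "(i, i) \<notin> G"
proof
  assume G: "(i, i) \<in> G"
  define M' where "M' = insert (i, i) {e \<in> M. snd e \<noteq> i}"
  have m: "matching G M" "T \<subseteq> snd ` M" "\<And>M'. matching_a G T M' \<Longrightarrow> card (M' \<inter> Id) \<le> card (M \<inter> Id)"
    using assms by (auto simp: matching_b_def matching_a_def)
  have "matching G M'"
    using m(1) G assms(3) unfolding matching_def M'_def inj_on_def by (auto simp: image_iff)
  moreover have "T \<subseteq> snd ` M'"
    using m(2) unfolding M'_def by (force simp: image_iff)
  ultimately have "card (M' \<inter> Id) \<le> card (M \<inter> Id)"
    by (intro m(3)) (simp add: matching_a_def)
  moreover have "M' \<inter> Id = insert (i, i) (M \<inter> Id)"
    using assms(3) unfolding M'_def by (auto simp: image_iff)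
  moreover have "(i, i) \<notin> M" using assms(3) by (auto simp: image_iff)
  ultimately show False using assms(2) by simp
qed

section \<open>Exchange arguments against a Nash welfare maximizing allocation\<close>

locale nw_optimal =
  fixes n :: nat and \<M> :: "'a set" and v :: "nat \<Rightarrow> 'a \<Rightarrow> real" and X :: "nat \<Rightarrow> 'a set"
  assumes n_pos: "0 < n" and finite_items: "finite \<M>"
    and v_pos: "\<forall>i<n. \<forall>g\<in>\<M>. 0 < v i g"
    and X_allocation: "allocation n \<M> X" and X_optimal: "NW n v X = opt n v \<M>"
begin

lemma X_subset: "i < n \<Longrightarrow> X i \<subseteq> \<M>"
  using X_allocation by (auto simp: allocation_def)

lemma v_nonneg: "i < n \<Longrightarrow> S \<subseteq> \<M> \<Longrightarrow> \<forall>g\<in>S. 0 \<le> v i g"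
  using v_pos by (meson less_imp_le subsetD)

lemma val_nonneg: "i < n \<Longrightarrow> S \<subseteq> \<M> \<Longrightarrow> 0 \<le> val v i S"
  unfolding val_def by (intro sum_nonneg) (auto dest: v_nonneg)

lemma finite_bundle: "S \<subseteq> \<M> \<Longrightarrow> finite S"
  using finite_items finite_subset by blast

lemma val_mono_items: "i < n \<Longrightarrow> B \<subseteq> \<M> \<Longrightarrow> A \<subseteq> B \<Longrightarrow> val v i A \<le> val v i B"
  by (intro val_mono finite_bundle v_nonneg)

lemma val_Un: "A \<subseteq> \<M> \<Longrightarrow> B \<subseteq> \<M> \<Longrightarrow> A \<inter> B = {} \<Longrightarrow> val v i (A \<union> B) = val v i A + val v i B"
  unfolding val_def by (intro sum.union_disjoint finite_bundle)

lemma opt_nonneg: "0 \<le> opt n v \<M>"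
  unfolding X_optimal[symmetric] NW_def using n_pos X_subset
  by (intro real_root_ge_zero prod_nonneg) (auto intro: val_nonneg)

lemma prod_le_optimal:
  assumes "allocation n \<M> W"
  shows "(\<Prod>i<n. val v i (W i)) \<le> (\<Prod>i<n. val v i (X i))"
proof -
  have "NW n v W \<le> opt n v \<M>"
    unfolding opt_def by (rule Max_ge[OF finite_NW_values[OF finite_items]]) (use assms in auto)
  then show ?thesis
    using n_pos unfolding X_optimal[symmetric] NW_def by simp
qed

lemma val_X_pos:
  assumes "0 < opt n v \<M>" and "i < n"
  shows "0 < val v i (X i)"
proof -
  have "val v i (X i) \<noteq> 0"
  proof
    assume "val v i (X i) = 0"
    then have "(\<Prod>i<n. val v i (X i)) = 0" using assms by (intro prod_zero) auto
    then have "NW n v X = 0" by (simp only: NW_def real_root_zero)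
    then show False using assms(1) X_optimal by simp
  qed
  then show ?thesis using val_nonneg[OF assms(2) X_subset[OF assms(2)]] by linarith
qed

lemma empty_bundle_if_opt_zero:
  assumes "opt n v \<M> = 0"
  obtains e where "e < n" and "X e = {}"
proof -
  have "(\<Prod>i<n. val v i (X i)) = 0"
    using assms n_pos unfolding X_optimal[symmetric] NW_def by simp
  then obtain e where e: "e < n" "val v e (X e) = 0" by auto
  have "X e = {}"
  proof (rule ccontr)
    assume "X e \<noteq> {}"
    then have "0 < val v e (X e)"
      unfolding val_def using e(1) X_subset[of e] v_pos finite_bundle
      by (intro sum_pos) auto
    then show False using e(2) by simp
  qed
  then show thesis using that e by blast
qed

text \<open>By additivity, returning the removed items shifts both \<open>Z\<close> and
  \<open>V\<close> by the same amounts, so an improvement of \<open>Z\<close> becomes one of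
  \<open>X\<close>. A positive optimum makes all factors positive, so that a gain in one factor
  strictly increases the product.\<close>

lemma not_improvable:
  assumes "0 < opt n v \<M>" and "\<forall>i<n. Z i \<subseteq> X i" and "allocation n (\<Union>i<n. Z i) V"
    and "\<forall>i<n. val v i (Z i) \<le> val v i (V i)" and "k < n"
  shows "val v k (V k) \<le> val v k (Z k)"
proof (rule ccontr)
  assume k: "\<not> val v k (V k) \<le> val v k (Z k)"
  define W where "W = (\<lambda>i. (X i - Z i) \<union> V i)"
  have W: "allocation n \<M> W"
    unfolding W_def by (rule allocation_union) (use assms X_allocation in auto)
  have eq: "val v i (W i) = val v i (X i) - val v i (Z i) + val v i (V i)" if i: "i < n" for i
  proof -
    have sub: "X i \<subseteq> \<M>" "W i \<subseteq> \<M>" using X_subset i W by (auto simp: allocation_def)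
    have "(X i - Z i) \<inter> V i = {}"
    proof -
      have "x \<notin> V i" if x: "x \<in> X i" "x \<notin> Z i" for x
      proof
        assume "x \<in> V i"
        then obtain b where b: "b < n" "x \<in> Z b" using assms(3) i by (auto simp: allocation_def)
        then have "x \<in> X b" using assms(2) by blast
        then have "b = i"
          using x i b X_allocation by (auto simp: allocation_def disjoint_family_on_def)
        then show False using b x by simp
      qed
      then show ?thesis by blast
    qed
    then have "val v i (W i) = val v i (X i - Z i) + val v i (V i)"
      unfolding W_def using sub by (intro val_Un) (auto simp: W_def)
    moreover have "val v i (X i) = val v i (X i - Z i) + val v i (Z i)"
    proof -
      have "X i = (X i - Z i) \<union> Z i" using assms(2) i by blast
      moreover have "val v i ((X i - Z i) \<union> Z i) = val v i (X i - Z i) + val v i (Z i)"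
        using sub assms(2) i by (intro val_Un) auto
      ultimately show ?thesis by simp
    qed
    ultimately show ?thesis by simp
  qed
  have "(\<Prod>i<n. val v i (X i)) < (\<Prod>i<n. val v i (W i))"
  proof (rule prod_less_single[where k = k])
    show "val v k (X k) < val v k (W k)" using k eq assms(5) by simp
    show "val v a (X a) \<le> val v a (W a)" if "a \<in> {..<n}" for a
      using that eq assms(4) by simp
  qed (use assms(1,5) val_X_pos in auto)
  then show False using prod_le_optimal[OF W] by simp
qed

text \<open>
  Suppose bundle \<open>j\<close> is matched to another agent.  Following the matching backwards from \<open>j\<close> gives a
  set \<open>A\<close> of agents, each of which (except possibly \<open>j\<close>) is matched to a bundle of \<open>A\<close>.  If \<open>j\<close> is too,
  shifting the bundles along \<open>A\<close> improves \<open>X\<close>.  Otherwise some \<open>u\<close> in \<open>A\<close> has an unmatched, hence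
  untouched, bundle; shifting then lets \<open>u\<close> keep \<open>X u\<close> in addition to a bundle it prefers to \<open>X u\<close>,
  and leaves \<open>j\<close> with \<open>X j - Z j\<close>, which must not be worth more than half of \<open>X j\<close>.
\<close>
lemma shift_along_matching:
  assumes opt: "0 < opt n v \<M>" and ZX: "\<forall>j<n. Z j \<subseteq> X j"
    and N: "matching (feasibility_graph n v Z) N" and T: "touched n X Z \<subseteq> snd ` N"
    and ij: "(i, j) \<in> N" "i \<noteq> j"
  shows "val v j (X j) \<le> 2 * val v j (Z j)" and "\<exists>u<n. u \<notin> snd ` N"
proof -
  have NG: "N \<subseteq> feasibility_graph n v Z" and inj1: "inj_on fst N" and inj2: "inj_on snd N"
    using N by (auto simp: matching_def)
  have fun1: "b = b'" if "(a, b) \<in> N" "(a, b') \<in> N" for a b b'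
    using inj_onD[OF inj1 _ that] by simp
  have fun2: "a = a'" if "(a, b) \<in> N" "(a', b) \<in> N" for a a' b
    using inj_onD[OF inj2 _ that] by simp
  have Nn: "a < n" "b < n" if "(a, b) \<in> N" for a b
    using NG that feasibility_graph_subset[of n v Z] by auto
  have better: "val v a (Z a) \<le> val v a (Z b)" "a \<noteq> b \<Longrightarrow> val v a (Z a) < val v a (Z b)"
    if "(a, b) \<in> N" for a b
    using NG that by (cases "a = b"; auto simp: feasibility_graph_def)+
  have Zsub: "Z a \<subseteq> \<M>" if "a < n" for a using ZX X_subset that by blast
  have jn: "j < n" and in': "i < n" using Nn ij by auto
  \<comment> \<open>Agents and bundles share their indices, so edges can be composed:
    \<open>A\<close> consists of the vertices from which a chain of edges leads to
    \<open>j\<close>.\<close>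
  define A where "A = (N\<inverse>)\<^sup>* `` {j}"
  have jA: "j \<in> A" by (simp add: A_def)
  have A_closed: "a \<in> A" if "(a, b) \<in> N" "b \<in> A" for a b
    using that unfolding A_def by (auto intro: rtrancl_into_rtrancl)
  have A_out: "\<exists>b\<in>A. (a, b) \<in> N" if "a \<in> A" "a \<noteq> j" for a
    using that unfolding A_def by (auto elim: rtranclE)
  have An: "a < n" if "a \<in> A" for a
    using that A_out Nn jn by blast
  have finA: "finite A" by (rule finite_subset[of _ "{..<n}"]) (use An in auto)
  \<comment> \<open>An unmatched bundle of \<open>A\<close> stays with its owner, who may receive a
    second bundle; this is how \<open>u\<close> below obtains two.\<close>
  define \<tau> where "\<tau> b = (if b \<in> A \<and> b \<in> snd ` N then THE a. (a, b) \<in> N else b)" for b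
  have \<tau>_eq: "\<tau> b = a" if "(a, b) \<in> N" "b \<in> A" for a b
  proof -
    have "(THE a. (a, b) \<in> N) = a" using that fun2 by blast
    then show ?thesis using that by (force simp: \<tau>_def)
  qed
  have \<tau>_N: "(\<tau> b, b) \<in> N" if "b \<in> A" "b \<in> snd ` N" for b
    using that \<tau>_eq by auto
  have \<tau>_self: "\<tau> b = b" if "b \<notin> A \<or> b \<notin> snd ` N" for b using that by (auto simp: \<tau>_def)
  have \<tau>n: "\<forall>b<n. \<tau> b < n"
    using \<tau>_N \<tau>_self Nn by metis
  define V where "V a = (\<Union>b\<in>{b. b < n \<and> \<tau> b = a}. Z b)" for a
  have Zal: "allocation n (\<Union>i<n. Z i) Z"
    using allocation_subfamily[OF X_allocation ZX] .
  have V: "allocation n (\<Union>i<n. Z i) V"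
    using allocation_regroup[OF Zal \<tau>n] by (simp add: V_def[abs_def])
  have Vsub: "V a \<subseteq> \<M>" if "a < n" for a
    using Zsub by (auto simp: V_def)
  have V_ge: "val v a (Z b) \<le> val v a (V a)" if "b < n" "\<tau> b = a" "a < n" for a b
    by (rule val_mono_items) (use that Vsub in \<open>auto simp: V_def\<close>)
  have V_mono: "val v a (Z a) \<le> val v a (V a)" if "a < n" "a \<noteq> j \<or> (\<exists>b\<in>A. (j, b) \<in> N)" for a
  proof (cases "a \<in> A")
    case True
    have "\<exists>b\<in>A. (a, b) \<in> N" using that(2) A_out[OF True] by (cases "a = j") auto
    then obtain b where b: "b \<in> A" "(a, b) \<in> N" by blast
    have "val v a (Z b) \<le> val v a (V a)" using V_ge[OF Nn(2)[OF b(2)] \<tau>_eq[OF b(2,1)] that(1)] .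
    then show ?thesis using better(1)[OF b(2)] by simp
  qed (use that V_ge[of a a] \<tau>_self in auto)
  \<comment> \<open>Otherwise the shift closes up: nobody loses, not even \<open>j\<close>, while
    \<open>i\<close> strictly gains by receiving \<open>Z j\<close>.\<close>
  have not_hit: "(j, b) \<notin> N" if b: "b \<in> A" for b
  proof
    assume jb: "(j, b) \<in> N"
    have "\<tau> j = i" using \<tau>_eq ij jA by blast
    then have "val v i (Z i) < val v i (V i)"
      using better(2)[OF ij] V_ge[of j i] jn in' by linarith
    moreover have "val v i (V i) \<le> val v i (Z i)"
      by (rule not_improvable[OF opt ZX V _ in']) (use V_mono jb b in blast)
    ultimately show False by simp
  qed
  \<comment> \<open>If all bundles of \<open>A\<close> were matched, \<open>\<tau>\<close> would
    permute the finite set \<open>A\<close>, and the bundle that it sends to \<open>j\<close> would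
    give an edge excluded by \<open>not_hit\<close>.\<close>
  have "\<exists>u\<in>A. u \<notin> snd ` N"
  proof (rule ccontr)
    assume *: "\<not> (\<exists>u\<in>A. u \<notin> snd ` N)"
    have "\<tau> ` A \<subseteq> A" using * \<tau>_N A_closed by blast
    moreover have "inj_on \<tau> A"
      using * \<tau>_N fun1 unfolding inj_on_def by metis
    ultimately have "\<tau> ` A = A" using finA by (simp add: endo_inj_surj)
    then obtain b where "b \<in> A" "\<tau> b = j" using jA by (metis imageE)
    then show False using * \<tau>_N not_hit by metis
  qed
  then obtain u where u: "u \<in> A" "u \<notin> snd ` N" by blast
  have un: "u < n" using An u by blast
  then show "\<exists>u<n. u \<notin> snd ` N" using u by blast
  have uj: "u \<noteq> j" using u ij by force
  then obtain b where b: "b \<in> A" "(u, b) \<in> N" using A_out u by blast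
  have bu: "b \<noteq> u" using b u by force
  have bn: "b < n" using An b by blast
  have "u \<notin> touched n X Z" using T u by blast
  then have Zu: "Z u = X u" using un ZX by (auto simp: touched_def)
  show "val v j (X j) \<le> 2 * val v j (Z j)"
  proof (rule ccontr)
    assume half: "\<not> val v j (X j) \<le> 2 * val v j (Z j)"
    define W where "W = (\<lambda>i. (X i - Z i) \<union> V i)"
    have W: "allocation n \<M> W"
      unfolding W_def by (rule allocation_union) (use ZX V X_allocation in auto)
    have Wsub: "W a \<subseteq> \<M>" if "a < n" for a using W that by (auto simp: allocation_def)
    have split: "val v a (X a) = val v a (X a - Z a) + val v a (Z a)" if "a < n" for a
    proof -
      have "X a = (X a - Z a) \<union> Z a" using ZX that by blast
      moreover have "val v a ((X a - Z a) \<union> Z a) = val v a (X a - Z a) + val v a (Z a)"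
        using X_subset Zsub that by (intro val_Un) auto
      ultimately show ?thesis by simp
    qed
    have disj: "(X a - Z a) \<inter> V a = {}" if a: "a < n" for a
    proof -
      have "x \<notin> V a" if x: "x \<in> X a" "x \<notin> Z a" for x
      proof
        assume "x \<in> V a"
        then obtain c where c: "c < n" "x \<in> Z c" by (auto simp: V_def)
        then have "x \<in> X c" using ZX by blast
        then have "c = a"
          using x a c X_allocation by (auto simp: allocation_def disjoint_family_on_def)
        then show False using c x by simp
      qed
      then show ?thesis by blast
    qed
    have Weq: "val v a (W a) = val v a (X a - Z a) + val v a (V a)" if "a < n" for a
      unfolding W_def using that disj X_subset Vsub by (intro val_Un) auto
    have "(\<Prod>i<n. val v i (X i)) < (\<Prod>i<n. val v i (W i))"
    proof (rule prod_less_pair[where k = j and l = u])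
      show "0 < val v a (X a)" if "a \<in> {..<n}" for a using that val_X_pos opt by auto
      show "val v a (X a) \<le> val v a (W a)" if "a \<in> {..<n}" "a \<noteq> j" "a \<noteq> u" for a
        using that split Weq V_mono by auto
      show "val v j (X j) < 2 * val v j (W j)"
        using half split[OF jn] Weq[OF jn] val_nonneg[OF jn Vsub[OF jn]] by simp
      have "Z b \<inter> Z u = {}"
        using Zal bn un bu by (auto simp: allocation_def disjoint_family_on_def)
      then have "val v u (Z b) + val v u (Z u) = val v u (Z b \<union> Z u)"
        using Zsub bn un by (intro val_Un[symmetric]) auto
      also have "\<dots> \<le> val v u (V u)"
      proof (rule val_mono_items)
        have "\<tau> b = u" "\<tau> u = u" using \<tau>_eq b \<tau>_self u by auto
        then show "Z b \<union> Z u \<subseteq> V u" using bn un by (auto simp: V_def)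
      qed (use un Vsub in auto)
      finally show "2 * val v u (X u) < val v u (W u)"
        using better(2)[OF b(2) bu[symmetric]] Weq[OF un] split[OF un] unfolding Zu by linarith
    qed (use jn un uj in auto)
    then show False using prod_le_optimal[OF W] by simp
  qed
qed

text \<open>The loop invariant. A matching covering the touched bundles has to exist for the next
  selection to be possible. The last two clauses come from exchanges against \<open>X\<close>, which
  have force only when the optimum is positive.\<close>

definition safe :: "(nat \<Rightarrow> 'a set) \<Rightarrow> bool" where
  "safe Z \<longleftrightarrow> (\<forall>j<n. Z j \<subseteq> X j) \<and>
     (\<exists>M. matching_a (feasibility_graph n v Z) (touched n X Z) M) \<and>
     (0 < opt n v \<M> \<longrightarrow>
        (\<forall>j<n. val v j (X j) \<le> 2 * val v j (Z j)) \<and> (\<exists>u<n. u \<notin> touched n X Z))"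

lemma safe_subset: "safe Z \<Longrightarrow> j < n \<Longrightarrow> Z j \<subseteq> X j"
  by (simp add: safe_def)

lemma safe_subset_items: "safe Z \<Longrightarrow> j < n \<Longrightarrow> Z j \<subseteq> \<M>"
  using safe_subset X_subset by blast

lemma safe_initial: "safe X"
proof -
  have t: "touched n X X = {}" by (auto simp: touched_def)
  have "val v j (X j) \<le> 2 * val v j (X j)" if "j < n" for j
    using val_nonneg[OF that X_subset[OF that]] by simp
  moreover have "matching_a (feasibility_graph n v X) (touched n X X) {}"
    by (auto simp: matching_a_def matching_def t)
  ultimately show ?thesis unfolding safe_def t using n_pos by auto
qed

text \<open>For a loop, being an edge just means EFX feasibility. An unmatched agent has no loop, so
  some bundle minus an item beats its own, and the robust demand beats it all the more. It is not
  the agent's own bundle, which cannot lose an item and be worth more than before.\<close>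

lemma alg_choice_demand:
  assumes "safe Z" and "alg_choice n v X Z i j"
  shows "i < n" and "j < n" and "i \<noteq> j" and "val v i (Z i) < max_minus_one v i (Z j)"
proof -
  obtain M where M: "selectable n v X Z M" "i < n" "i \<notin> fst ` M" "robust_demand n v Z i j"
    using assms by (auto simp: alg_choice_def)
  show "i < n" "j < n" using M by (auto simp: robust_demand_def)
  have "matching_b (feasibility_graph n v Z) (touched n X Z) M"
    using M by (simp add: selectable_def matching_c_def)
  then have "(i, i) \<notin> feasibility_graph n v Z"
    using M(3) by (intro unmatched_not_loop matching_finite)
      (auto simp: matching_b_def matching_a_def)
  then obtain k where "k < n" "val v i (Z i) < max_minus_one v i (Z k)"
    using M(2) by (auto simp: feasibility_graph_def efx_feasible_def not_le)
  then show less: "val v i (Z i) < max_minus_one v i (Z j)"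
    using M(4) unfolding robust_demand_def by force
  show "i \<noteq> j"
  proof
    assume [simp]: "i = j"
    have "max_minus_one v i (Z i) \<le> val v i (Z i)"
      using assms(1) M(2) safe_subset_items
      by (intro max_minus_one_le_val finite_bundle v_nonneg) auto
    then show False using less by simp
  qed
qed

lemma alg_choice_nonempty:
  assumes "safe Z" and "alg_choice n v X Z i j"
  shows "Z j \<noteq> {}"
proof
  assume "Z j = {}"
  then have "val v i (Z i) < 0"
    using alg_choice_demand(4)[OF assms] by (simp add: max_minus_one_def)
  moreover have "0 \<le> val v i (Z i)"
    using val_nonneg alg_choice_demand(1)[OF assms] safe_subset_items[OF assms(1)] by blast
  ultimately show False by simp
qed

text \<open>The old matching is repaired by giving the shrunken bundle \<open>j\<close> to the
  unmatched agent \<open>i\<close>. The new edge is off the diagonal, so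
  \<open>shift_along_matching\<close> applies to the repaired matching and bounds the loss of
  exactly the bundle that has changed.\<close>

lemma safe_step:
  assumes safe: "safe Z" and step: "alg_step n v X Z Z'"
  shows "safe Z'"
proof -
  obtain i j c where ch: "alg_choice n v X Z i j" and c: "c \<in> Z j" "\<forall>d\<in>Z j. v i c \<le> v i d"
    and Z': "Z' = Z(j := Z j - {c})" using step by (auto simp: alg_step_def)
  obtain M where M: "selectable n v X Z M" "i \<notin> fst ` M" "robust_demand n v Z i j"
    using ch by (auto simp: alg_choice_def)
  note d = alg_choice_demand[OF safe ch]
  have sub: "Z k \<subseteq> \<M>" if "k < n" for k using safe_subset_items safe that .
  have sub': "Z' k \<subseteq> Z k" for k by (auto simp: Z')
  have mmo: "max_minus_one v a (Z' k) \<le> max_minus_one v a (Z k)" if "a < n" "k < n" for a k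
    using that sub sub' by (intro max_minus_one_mono finite_bundle v_nonneg) auto
  have vle: "val v a (Z' k) \<le> val v a (Z k)" if "a < n" "k < n" for a k
    using that sub sub' by (intro val_mono_items) auto
  have mmo_j: "max_minus_one v i (Z j) = val v i (Z' j)"
    unfolding Z' using c d sub by (simp add: max_minus_one_min[OF finite_bundle v_nonneg])
  have mM: "matching (feasibility_graph n v Z) M" "touched n X Z \<subseteq> snd ` M"
    using M(1) by (auto simp: selectable_def matching_c_def matching_b_def matching_a_def)
  define N where "N = insert (i, j) {e \<in> M. snd e \<noteq> j}"
  \<comment> \<open>By \<open>mmo_j\<close> the new value of bundle \<open>j\<close> for
    \<open>i\<close> is the largest of the old thresholds, and the new thresholds are no
    larger.\<close>
  have edge: "(i, j) \<in> feasibility_graph n v Z'"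
  proof -
    have "max_minus_one v i (Z' k) \<le> val v i (Z' j)" if "k < n" for k
      using mmo[of i k] d that M(3) unfolding mmo_j[symmetric] robust_demand_def
      by (meson order_trans)
    moreover have "val v i (Z' i) < val v i (Z' j)"
      using d mmo_j by (simp add: Z')
    ultimately show ?thesis using d by (auto simp: feasibility_graph_def efx_feasible_def)
  qed
  \<comment> \<open>The bundle itself is unchanged, while everything it has to exceed can only have
    dropped, including the agent's own bundle.\<close>
  have old: "(a, b) \<in> feasibility_graph n v Z'" if "(a, b) \<in> M" "b \<noteq> j" for a b
  proof -
    have G: "(a, b) \<in> feasibility_graph n v Z" using mM(1) that by (auto simp: matching_def)
    have "Z' b = Z b" using that by (simp add: Z')
    moreover from G have "a < n" "b < n" by (auto simp: feasibility_graph_def)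
    moreover have "max_minus_one v a (Z' k) \<le> val v a (Z b)" if "k < n" for k
      using mmo[of a k] G that by (force simp: feasibility_graph_def efx_feasible_def)
    ultimately show ?thesis
      using G vle[of a a] by (auto simp: feasibility_graph_def efx_feasible_def)
  qed
  have N: "matching (feasibility_graph n v Z') N"
    using mM(1) edge old M(2) unfolding matching_def N_def inj_on_def by (auto simp: image_iff)
  have "touched n X Z' \<subseteq> insert j (touched n X Z)" by (auto simp: touched_def Z')
  moreover have "insert j (touched n X Z) \<subseteq> snd ` N"
    using mM(2) by (force simp: N_def image_iff)
  ultimately have T: "touched n X Z' \<subseteq> snd ` N" by blast
  have Z'X: "\<forall>k<n. Z' k \<subseteq> X k" using safe_subset[OF safe] sub' by blast
  have "(\<forall>k<n. val v k (X k) \<le> 2 * val v k (Z' k)) \<and> (\<exists>u<n. u \<notin> touched n X Z')"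
    if opt: "0 < opt n v \<M>"
  proof
    have ij: "(i, j) \<in> N" by (simp add: N_def)
    note sh = shift_along_matching[OF opt Z'X N T ij d(3)]
    show "\<exists>u<n. u \<notin> touched n X Z'" using sh(2) T by blast
    show "\<forall>k<n. val v k (X k) \<le> 2 * val v k (Z' k)"
    proof (intro allI impI)
      fix k assume "k < n"
      then show "val v k (X k) \<le> 2 * val v k (Z' k)"
        using sh(1) safe opt unfolding safe_def by (cases "k = j") (auto simp: Z')
    qed
  qed
  then show ?thesis unfolding safe_def using Z'X N T by (auto simp: matching_a_def)
qed

lemma safe_steps: "(alg_step n v X)\<^sup>*\<^sup>* X Z \<Longrightarrow> safe Z"
  by (induction rule: rtranclp_induct) (auto intro: safe_initial safe_step)

section \<open>Number of iterations, perfect matchings and the output\<close>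

lemma alg_step_card:
  assumes "safe Z" and "alg_step n v X Z Z'"
  shows "(\<Sum>j<n. card (Z j)) = Suc (\<Sum>j<n. card (Z' j))"
proof -
  obtain i j c where ch: "alg_choice n v X Z i j" and c: "c \<in> Z j"
    and Z': "Z' = Z(j := Z j - {c})" using assms by (auto simp: alg_step_def)
  have j: "j < n" using alg_choice_demand(2)[OF assms(1) ch] .
  have "finite (Z j)" using safe_subset_items[OF assms(1) j] finite_bundle by blast
  then have "card (Z j) = Suc (card (Z' j))"
    using c using card.remove[of "Z j" c] by (simp add: Z')
  moreover have "(\<Sum>k\<in>{..<n} - {j}. card (Z k)) = (\<Sum>k\<in>{..<n} - {j}. card (Z' k))"
    by (rule sum.cong) (auto simp: Z')
  ultimately show ?thesis using j by (simp add: sum.remove[of "{..<n}" j])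
qed

lemma sum_card_X: "(\<Sum>j<n. card (X j)) = card \<M>"
proof -
  have "card (\<Union>j\<in>{..<n}. X j) = (\<Sum>j<n. card (X j))"
    using X_allocation X_subset finite_bundle
    by (intro card_UN_disjoint') (auto simp: allocation_def)
  then show ?thesis using X_allocation by (simp add: allocation_def)
qed

lemma alg_steps_bound:
  assumes "(alg_step n v X ^^ k) X Z"
  shows "k \<le> card \<M>"
proof -
  have "(\<Sum>j<n. card (Z j)) + k = card \<M>" using assms
  proof (induction k arbitrary: Z)
    case 0
    then show ?case using sum_card_X by simp
  next
    case (Suc k)
    then obtain U where U: "(alg_step n v X ^^ k) X U" "alg_step n v X U Z" by auto
    have "safe U" using U(1) relpowp_imp_rtranclp safe_steps by metis
    then show ?case using Suc.IH[OF U(1)] alg_step_card[OF _ U(2)] by simp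
  qed
  then show ?thesis by simp
qed

lemma selectable_perfect_loops:
  assumes safe: "safe Z" and M: "selectable n v X Z M" "card M = n"
  shows "M \<subseteq> Id"
proof (rule ccontr)
  assume "\<not> M \<subseteq> Id"
  then obtain i j where ij: "(i, j) \<in> M" "i \<noteq> j" by auto
  have mM: "matching (feasibility_graph n v Z) M" "touched n X Z \<subseteq> snd ` M"
    using M(1) by (auto simp: selectable_def matching_c_def matching_b_def matching_a_def)
  note full = matching_finite[OF mM(1)]
  show False
  proof (cases "opt n v \<M> = 0")
    case False
    then have "0 < opt n v \<M>" using opt_nonneg by simp
    then show False
      using shift_along_matching(2)[OF _ _ mM ij] safe_subset[OF safe] full(4) M(2) by auto
  next
    case True
    then obtain e where e: "e < n" "X e = {}" using empty_bundle_if_opt_zero by blast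
    then have Ze: "Z e = {}" using safe_subset[OF safe] by blast
    have "e \<in> snd ` M" using full(4)[OF M(2)] e(1) by simp
    \<comment> \<open>The agent \<open>a\<close> matched to the empty bundle finds value 0 feasible.
      Since items have positive value, no bundle can then contain two items.\<close>
    then obtain a where a: "(a, e) \<in> M" by auto
    then have fe: "a < n" "\<forall>k<n. max_minus_one v a (Z k) \<le> 0"
      using mM(1) Ze by (auto simp: matching_def feasibility_graph_def efx_feasible_def val_def)
    have single: "g = h" if "k < n" "g \<in> Z k" "h \<in> Z k" for k g h
    proof (rule ccontr)
      assume gh: "g \<noteq> h"
      have sub: "Z k \<subseteq> \<M>" using safe_subset_items safe that(1) .
      have "0 < v a h" using sub that v_pos fe(1) by blast
      also have "v a h = val v a {h}" by (simp add: val_def)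
      also have "\<dots> \<le> val v a (Z k - {g})"
        using sub that gh fe(1) by (intro val_mono_items) auto
      also have "\<dots> \<le> max_minus_one v a (Z k)"
        using sub that by (intro max_minus_one_ge finite_bundle)
      finally show False using fe(2) that(1) by force
    qed
    have mmo: "max_minus_one v b (Z k) \<le> 0" if "k < n" "b < n" for b k
    proof (rule max_minus_one_leI)
      show "finite (Z k)" using safe_subset_items[OF safe that(1)] finite_bundle by blast
      fix g assume "g \<in> Z k"
      then have "Z k - {g} = {}" using single that(1) by blast
      then show "val v b (Z k - {g}) \<le> 0" by (simp only: val_def sum.empty)
    qed simp
    \<comment> \<open>With at most one item per bundle all loops are edges, so the full diagonal
      competes with \<open>M\<close> under criterion (b).\<close>
    define D where "D = (\<lambda>i. (i, i)) ` {..<n}"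
    have "max_minus_one v b (Z k) \<le> val v b (Z b)" if "k < n" "b < n" for b k
      using mmo[OF that] val_nonneg[OF that(2) safe_subset_items[OF safe that(2)]] by simp
    then have "D \<subseteq> feasibility_graph n v Z"
      by (auto simp: D_def feasibility_graph_def efx_feasible_def)
    moreover have "snd ` D = {..<n}" by (force simp: D_def)
    ultimately have "matching_a (feasibility_graph n v Z) (touched n X Z) D"
      by (auto simp: matching_a_def matching_def inj_on_def D_def touched_def)
    then have "card (D \<inter> Id) \<le> card (M \<inter> Id)"
      using M(1) by (simp add: selectable_def matching_c_def matching_b_def)
    moreover have "D \<inter> Id = D" by (auto simp: D_def)
    moreover have "card D = n" by (simp add: D_def card_image inj_on_def)
    ultimately have "card M \<le> card (M \<inter> Id)" using M(2) by simp
    then have "M \<inter> Id = M" by (intro card_seteq full(1)) auto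
    then show False using ij by auto
  qed
qed

lemma selectable_perfect:
  assumes "safe Z" and "selectable n v X Z M" and "card M = n"
  shows "M = (\<lambda>i. (i, i)) ` {..<n}"
proof -
  have mM: "matching (feasibility_graph n v Z) M"
    using assms(2) by (auto simp: selectable_def matching_c_def matching_b_def matching_a_def)
  have "M \<subseteq> Id" using selectable_perfect_loops assms by blast
  moreover have "fst ` M = {..<n}" using matching_finite(3)[OF mM] assms(3) by simp
  ultimately have M_eq: "\<And>a b. (a, b) \<in> M \<Longrightarrow> a = b" "fst ` M = {..<n}" by blast+
  show ?thesis
  proof (intro equalityI subrelI)
    fix a b assume "(a, b) \<in> M"
    moreover from this have "a \<in> fst ` M" by (rule image_eqI[rotated]) simp
    ultimately show "(a, b) \<in> (\<lambda>i. (i, i)) ` {..<n}" using M_eq by auto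
  next
    fix a b assume e: "(a, b) \<in> (\<lambda>i. (i, i)) ` {..<n}"
    then have "a \<in> fst ` M" using M_eq(2) by auto
    then obtain c where c: "(a, c) \<in> M" by auto
    then show "(a, b) \<in> M" using M_eq(1)[OF c] e by auto
  qed
qed

text \<open>The final matching is the identity, so \<open>Y\<close> agrees with the last family
  \<open>Z\<close>. Its loops are edges, which is precisely the EFX condition, and a Pareto
  improvement would contradict \<open>not_improvable\<close>.\<close>

theorem alg_output_properties:
  assumes "alg_output n v X Y"
  shows "allocation n (\<Union>i<n. Y i) Y" and "efficient n v \<M> (2 powr (1 - 1 / real n)) Y"
    and "EFX n v Y" and "0 < opt n v \<M> \<Longrightarrow> pareto_optimal n v (\<Union>i<n. Y i) Y"
    and "\<forall>i<n. Y i \<subseteq> X i"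
proof -
  obtain Z M where Z: "(alg_step n v X)\<^sup>*\<^sup>* X Z" and M: "selectable n v X Z M" "card M = n"
    and YZ: "\<forall>(i, j)\<in>M. Y i = Z j" using assms by (auto simp: alg_output_def)
  have safe: "safe Z" using safe_steps Z .
  have ii: "(i, i) \<in> M" if "i < n" for i
    using selectable_perfect[OF safe M] that by simp
  then have Y: "Y i = Z i" if "i < n" for i using YZ that by blast
  have G: "(i, i) \<in> feasibility_graph n v Z" if "i < n" for i
    using ii[OF that] M(1)
    by (auto simp: selectable_def matching_c_def matching_b_def matching_a_def matching_def)
  show YX: "\<forall>i<n. Y i \<subseteq> X i" using Y safe_subset[OF safe] by simp
  then show al: "allocation n (\<Union>i<n. Y i) Y"
    using allocation_subfamily X_allocation by blast
  show "EFX n v Y"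
    using G by (auto simp: EFX_def Y feasibility_graph_def efx_feasible_def)
  show "pareto_optimal n v (\<Union>i<n. Y i) Y" if "0 < opt n v \<M>"
    unfolding pareto_optimal_def using al not_improvable[OF that YX] by (meson leD)
  have nn: "0 \<le> NW n v Y" unfolding NW_def using n_pos YX X_subset
    by (intro real_root_ge_zero prod_nonneg) (auto intro!: val_nonneg)
  have "opt n v \<M> \<le> 2 powr (1 - 1 / real n) * NW n v Y"
  proof (cases "opt n v \<M> = 0")
    case True
    then show ?thesis using nn by simp
  next
    case False
    then have opt: "0 < opt n v \<M>" using opt_nonneg by simp
    then obtain u where u: "u < n" "u \<notin> touched n X Z"
      and half: "\<forall>j<n. val v j (X j) \<le> 2 * val v j (Z j)"
      using safe by (auto simp: safe_def)
    have Zu: "Z u = X u" using u safe_subset[OF safe] by (auto simp: touched_def)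
    have "(\<Prod>i<n. val v i (X i)) = val v u (X u) * (\<Prod>i\<in>{..<n} - {u}. val v i (X i))"
      using u by (simp add: prod.remove)
    \<comment> \<open>The untouched bundle \<open>u\<close> needs no factor 2. This saves one of the
      \<open>n\<close> factors and gives the exponent \<open>1 - 1 / n\<close> after taking the
      root.\<close>
    also have "\<dots> \<le> val v u (X u) * (\<Prod>i\<in>{..<n} - {u}. 2 * val v i (Z i))"
      using u half X_subset val_nonneg by (intro mult_left_mono prod_mono) auto
    also have "\<dots> = 2 ^ (n - 1) * (\<Prod>i<n. val v i (Z i))"
      using u by (simp add: prod.distrib prod.remove[of "{..<n}" u] Zu)
    also have "(\<Prod>i<n. val v i (Z i)) = (\<Prod>i<n. val v i (Y i))"
      by (intro prod.cong) (auto simp: Y)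
    finally have "NW n v X \<le> root n (2 ^ (n - 1) * (\<Prod>i<n. val v i (Y i)))"
      unfolding NW_def using n_pos by simp
    also have "\<dots> = root n (2 ^ (n - 1)) * NW n v Y"
      by (simp add: NW_def real_root_mult)
    also have "root n (2 ^ (n - 1)) = 2 powr (1 - 1 / real n)"
    proof -
      have "root n (2 ^ (n - 1)) = root n (2 powr real (n - 1))"
        by (simp only: powr_realpow[of 2] zero_less_numeral)
      also have "\<dots> = (2 powr real (n - 1)) powr (1 / real n)"
        using n_pos by (intro root_powr_inverse) auto
      also have "\<dots> = 2 powr (1 - 1 / real n)"
        using n_pos by (simp add: powr_powr of_nat_diff diff_divide_distrib)
      finally show ?thesis .
    qed
    finally show ?thesis using X_optimal by simp
  qed
  moreover have "(\<Union>i<n. Y i) \<subseteq> \<M>" using YX X_subset by blast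
  ultimately show "efficient n v \<M> (2 powr (1 - 1 / real n)) Y"
    unfolding efficient_def using al by blast
qed

end

section \<open>Maximum-weight matchings by auction\<close>

text \<open>Non-edges have weight 0, so an assignment of all \<open>n\<close> agents to all
  \<open>n\<close> bundles can stand for a matching of any size: its pairs of weight 0 are
  discarded.\<close>

definition edge_weight :: "nat \<Rightarrow> nat set \<Rightarrow> (nat \<times> nat) set \<Rightarrow> nat \<times> nat \<Rightarrow> nat" where
  "edge_weight K T G e =
     (if e \<in> G then K + (if fst e = snd e then K * K else 0) + (if snd e \<in> T then K * (K * K) else 0)
      else 0)"

lemma sum_edge_weight:
  assumes "matching G M" and "finite M"
  shows "sum (edge_weight K T G) M =
    K * (card M + K * card (M \<inter> Id) + K * K * card (T \<inter> snd ` M))"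
proof -
  have eq: "edge_weight K T G e =
      K * (1 + K * of_bool (e \<in> Id) + K * K * of_bool (snd e \<in> T))" if "e \<in> M" for e
    using that assms(1) by (cases e) (auto simp: edge_weight_def matching_def algebra_simps)
  have c1: "(\<Sum>e\<in>M. of_bool (e \<in> Id)) = card (M \<inter> Id)"
    using assms(2) by (simp add: of_bool_def sum.If_cases Int_def)
  have "(\<Sum>e\<in>M. of_bool (snd e \<in> T)) = card {e \<in> M. snd e \<in> T}"
    using assms(2) by (simp add: of_bool_def sum.If_cases Int_def)
  also have "\<dots> = card (snd ` {e \<in> M. snd e \<in> T})"
    using assms(1) by (intro card_image[symmetric]) (auto simp: matching_def inj_on_def)
  also have "snd ` {e \<in> M. snd e \<in> T} = T \<inter> snd ` M" by auto
  finally have c2: "(\<Sum>e\<in>M. of_bool (snd e \<in> T)) = card (T \<inter> snd ` M)" .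
  have "sum (edge_weight K T G) M =
      (\<Sum>e\<in>M. K * (1 + K * of_bool (e \<in> Id) + K * K * of_bool (snd e \<in> T)))"
    using eq by (rule sum.cong[OF refl])
  also have "\<dots> = K * (card M + K * (\<Sum>e\<in>M. of_bool (e \<in> Id)) + K * K * (\<Sum>e\<in>M. of_bool (snd e \<in> T)))"
    by (simp only: sum_distrib_left[symmetric] sum.distrib card_eq_sum)
  finally show ?thesis using c1 c2 by simp
qed

text \<open>
  As matchings have fewer than \<open>K\<close> edges, the weights order them lexicographically by the
  three criteria; the extra factor \<open>K\<close> absorbs the additive error \<open>n\<close>.
\<close>
lemma near_max_weight_matching_c:
  assumes G: "G \<subseteq> {..<n} \<times> {..<n}" and M: "matching G M" and K: "n < K"
    and T: "finite T" "matching_a G T M\<^sub>a"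
    and max: "\<And>M'. matching G M' \<Longrightarrow> sum (edge_weight K T G) M' \<le> sum (edge_weight K T G) M + n"
  shows "matching_c G T M"
proof -
  define W where "W M = card M + K * card (M \<inter> Id) + K * K * card (T \<inter> snd ` M)" for M
  have fin: "finite M'" and small: "card M' \<le> n" if "matching G M'" for M'
  proof -
    have sub: "M' \<subseteq> {..<n} \<times> {..<n}" using that G by (auto simp: matching_def)
    then show "finite M'" by (rule finite_subset) simp
    have "card M' = card (fst ` M')" using that by (simp add: matching_def card_image)
    also have "\<dots> \<le> card {..<n}" using sub by (intro card_mono) auto
    finally show "card M' \<le> n" by simp
  qed
  \<comment> \<open>Weights are multiples of \<open>K\<close>, so an error of \<open>n < K\<close>
    cannot hide a difference in \<open>W\<close>.\<close>
  have W: "W M' \<le> W M" if M': "matching G M'" for M'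
  proof (rule ccontr)
    assume "\<not> W M' \<le> W M"
    then have "K * (W M + 1) \<le> K * W M'" by (intro mult_left_mono) auto
    moreover have "K * W M' \<le> K * W M + n"
      using max[OF M'] sum_edge_weight[OF M' fin[OF M'], of K T] sum_edge_weight[OF M fin[OF M], of K T]
      by (simp add: W_def)
    ultimately show False using K by (simp add: algebra_simps)
  qed
  have loops: "card (M' \<inter> Id) \<le> n" if "matching G M'" for M'
    using small[OF that] card_mono[OF fin[OF that], of "M' \<inter> Id"] by simp
  \<comment> \<open>A missing touched bundle costs \<open>K * K\<close>, while loops and size
    together contribute at most \<open>n + K * n\<close>, which is less.\<close>
  have cov: "T \<subseteq> snd ` M"
  proof (rule ccontr)
    assume "\<not> T \<subseteq> snd ` M"
    then have "T \<inter> snd ` M \<subset> T" by blast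
    then have "card (T \<inter> snd ` M) + 1 \<le> card T"
      using psubset_card_mono[OF T(1)] by (metis Suc_eq_plus1 Suc_leI)
    then have "K * K * (card (T \<inter> snd ` M) + 1) \<le> K * K * card T" by (intro mult_left_mono) auto
    also have "K * K * card T \<le> W M\<^sub>a"
    proof -
      have "T \<inter> snd ` M\<^sub>a = T" using T(2) by (auto simp: matching_a_def)
      then show ?thesis by (simp add: W_def)
    qed
    also have "W M\<^sub>a \<le> W M" using T(2) W by (simp add: matching_a_def)
    finally have "K * K \<le> card M + K * card (M \<inter> Id)" by (simp add: W_def)
    also have "\<dots> \<le> n + K * n" using small[OF M] loops[OF M] by (intro add_mono mult_left_mono) auto
    also have "\<dots> < K * (n + 1)" using K by simp
    also have "\<dots> \<le> K * K" using K by (intro mult_left_mono) auto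
    finally show False by simp
  qed
  have Wc: "card M' + K * card (M' \<inter> Id) \<le> card M + K * card (M \<inter> Id)" if "matching_a G T M'" for M'
  proof -
    have "T \<inter> snd ` M' = T" "T \<inter> snd ` M = T" using that cov by (auto simp: matching_a_def)
    then show ?thesis using W[of M'] that by (simp add: W_def matching_a_def)
  qed
  have b: "card (M' \<inter> Id) \<le> card (M \<inter> Id)" if "matching_a G T M'" for M'
  proof (rule ccontr)
    assume "\<not> card (M' \<inter> Id) \<le> card (M \<inter> Id)"
    then have "K * (card (M \<inter> Id) + 1) \<le> K * card (M' \<inter> Id)" by (intro mult_left_mono) auto
    then show False using Wc[OF that] small[OF M] K by (simp add: algebra_simps)
  qed
  have a: "matching_a G T M" using M cov by (simp add: matching_a_def)
  have "card M' \<le> card M" if M': "matching_b G T M'" for M'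
  proof -
    have "matching_a G T M'" using M' by (simp add: matching_b_def)
    moreover from this have "card (M' \<inter> Id) = card (M \<inter> Id)"
      using M' a b by (intro antisym) (auto simp: matching_b_def)
    ultimately show ?thesis using Wc by fastforce
  qed
  then show ?thesis using a b by (simp add: matching_c_def matching_b_def)
qed

text \<open>With the same weights, the three nested criteria become a single maximum over a finite
  set.\<close>

lemma matching_c_exists:
  assumes G: "G \<subseteq> {..<n} \<times> {..<n}" and T: "finite T" "matching_a G T M\<^sub>a"
  shows "\<exists>M. matching_c G T M"
proof -
  let ?w = "sum (edge_weight (Suc n) T G)"
  have "finite {M. matching G M}"
    by (rule finite_subset[of _ "Pow ({..<n} \<times> {..<n})"]) (use G in \<open>auto simp: matching_def\<close>)
  then have fin: "finite (?w ` {M. matching G M})" by simp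
  moreover have "matching G {}" by (simp add: matching_def)
  ultimately have "Max (?w ` {M. matching G M}) \<in> ?w ` {M. matching G M}" by (intro Max_in) auto
  then obtain M where M: "matching G M" "?w M = Max (?w ` {M. matching G M})" by auto
  have "?w M' \<le> ?w M" if "matching G M'" for M'
    unfolding M(2) using fin that by (intro Max_ge) auto
  then have "matching_c G T M"
    using near_max_weight_matching_c[OF G M(1) _ T, of "Suc n"] by (simp add: trans_le_add1)
  then show ?thesis ..
qed

text \<open>
  An auction with bid increment 1: \<open>p\<close> are the prices, and \<open>own j\<close> is the successor of the agent
  owning bundle \<open>j\<close>, or 0.  Each owner has a bundle that is best for it up to an error of 1.
\<close>
definition auction_inv ::
  "nat \<Rightarrow> (nat \<Rightarrow> nat \<Rightarrow> nat) \<Rightarrow> nat set \<Rightarrow> (nat \<Rightarrow> nat) \<Rightarrow> (nat \<Rightarrow> nat) \<Rightarrow> bool" where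
  "auction_inv n w S p own \<longleftrightarrow>
     (\<forall>j<n. own j = 0 \<longrightarrow> p j = 0) \<and>
     (\<forall>j<n. own j \<noteq> 0 \<longrightarrow> p j \<le> w (own j - 1) j + 1 \<and>
        (\<forall>k<n. w (own j - 1) k + p j \<le> w (own j - 1) j + p k + 1)) \<and>
     inj_on own {j. j < n \<and> own j \<noteq> 0} \<and> own ` {j. j < n \<and> own j \<noteq> 0} = Suc ` S"

lemma auction_inv_init: "auction_inv n w {} (\<lambda>j. 0) (\<lambda>j. 0)"
  by (simp add: auction_inv_def)

lemma auction_inv_cong:
  assumes "auction_inv n w S p own" and "\<And>j. j < n \<Longrightarrow> p' j = p j" and "\<And>j. j < n \<Longrightarrow> own' j = own j"
  shows "auction_inv n w S p' own'"
proof -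
  have "{j. j < n \<and> own' j \<noteq> 0} = {j. j < n \<and> own j \<noteq> 0}" using assms by auto
  moreover have "own' ` {j. j < n \<and> own j \<noteq> 0} = own ` {j. j < n \<and> own j \<noteq> 0}"
    by (rule image_cong) (use assms in auto)
  moreover have "inj_on own' {j. j < n \<and> own j \<noteq> 0} = inj_on own {j. j < n \<and> own j \<noteq> 0}"
    by (rule inj_on_cong) (use assms in auto)
  ultimately show ?thesis using assms(1) unfolding auction_inv_def by (simp add: assms(2,3))
qed

text \<open>The hypothesis \<open>best\<close> says that \<open>l\<close> maximizes the profit
  \<open>w i k - p k\<close>; it is written with sums because subtraction of naturals truncates. The
  previous owner of \<open>l\<close>, if there is one, loses its bundle. Raising the price by 1
  costs \<open>i\<close> at most the tolerated error and makes \<open>l\<close> less attractive to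
  everyone else.\<close>

lemma auction_bid:
  assumes inv: "auction_inv n w S p own" and S: "S \<subseteq> {..<n}" and i: "i < n" "i \<notin> S" and l: "l < n"
    and best: "\<forall>k<n. w i k + p l \<le> w i l + p k"
  shows "auction_inv n w (insert i (if own l = 0 then S else S - {own l - 1}))
           (p(l := Suc (p l))) (own(l := Suc i))"
proof -
  let ?D = "{j. j < n \<and> own j \<noteq> 0}"
  have inj: "inj_on own ?D" and im: "own ` ?D = Suc ` S"
    and free: "\<And>j. j < n \<Longrightarrow> own j = 0 \<Longrightarrow> p j = 0"
    and cs: "\<And>j k. j < n \<Longrightarrow> own j \<noteq> 0 \<Longrightarrow> k < n \<Longrightarrow> w (own j - 1) k + p j \<le> w (own j - 1) j + p k + 1"
    and bd: "\<And>j. j < n \<Longrightarrow> own j \<noteq> 0 \<Longrightarrow> p j \<le> w (own j - 1) j + 1"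
    using inv by (auto simp: auction_inv_def)
  \<comment> \<open>As \<open>i\<close> owns nothing, fewer than \<open>n\<close> bundles are owned.
    A free bundle costs 0, so the best profit is nonnegative; this gives \<open>pl\<close>, which
    keeps prices bounded.\<close>
  have "\<exists>j<n. own j = 0"
  proof (rule ccontr)
    assume "\<not> (\<exists>j<n. own j = 0)"
    then have D: "?D = {..<n}" by auto
    have "n = card (own ` ?D)" using card_image[OF inj] D by simp
    also have "\<dots> = card (Suc ` S)" by (simp only: im)
    also have "\<dots> = card S" by (simp add: card_image)
    also have "\<dots> < card {..<n}" using S i by (intro psubset_card_mono) auto
    finally show False by simp
  qed
  then have pl: "p l \<le> w i l" using best free by fastforce
  have D': "{j. j < n \<and> (own(l := Suc i)) j \<noteq> 0} = insert l ?D" using l by auto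
  have notin: "Suc i \<notin> own ` ?D" unfolding im using i by auto
  have "inj_on (own(l := Suc i)) (insert l ?D)"
    using inj notin unfolding inj_on_def by (auto simp: image_iff)
  moreover have "(own(l := Suc i)) ` insert l ?D =
      Suc ` insert i (if own l = 0 then S else S - {own l - 1})"
  proof -
    have "(own(l := Suc i)) ` insert l ?D = insert (Suc i) (own ` (?D - {l}))" by auto
    also have "own ` (?D - {l}) = Suc ` (if own l = 0 then S else S - {own l - 1})"
    proof (cases "own l = 0")
      case True
      then have "?D - {l} = ?D" by auto
      then show ?thesis using True im by simp
    next
      case False
      have "own ` (?D - {l}) = own ` ?D - own ` {l}"
        using False l by (intro inj_on_image_set_diff[OF inj]) auto
      also have "own ` {l} = Suc ` {own l - 1}" using False by simp
      also have "own ` ?D - Suc ` {own l - 1} = Suc ` (S - {own l - 1})"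
        by (simp only: im image_set_diff[OF inj_Suc])
      finally show ?thesis using False by simp
    qed
    finally show ?thesis by simp
  qed
  moreover have "\<forall>k<n. w i k + Suc (p l) \<le> w i l + (p(l := Suc (p l))) k + 1"
    using best by (auto simp: fun_upd_def)
  moreover have "w (own j - 1) k + p j \<le> w (own j - 1) j + (p(l := Suc (p l))) k + 1"
    if "j < n" "own j \<noteq> 0" "k < n" for j k
    using cs[OF that] by (auto simp: fun_upd_def)
  ultimately show ?thesis
    unfolding auction_inv_def D' using free bd pl by auto
qed

text \<open>Each bid raises one price by 1, so this bounds the total number of bids.\<close>

lemma auction_price_bound:
  assumes "auction_inv n w S p own" and "S \<subseteq> {..<n}" and "\<forall>i<n. \<forall>j<n. w i j \<le> C"
  shows "(\<Sum>j<n. p j) \<le> n * (C + 1)"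
proof -
  have "p j \<le> C + 1" if j: "j < n" for j
  proof (cases "own j = 0")
    case False
    then have "own j \<in> Suc ` S" using assms(1) j by (auto simp: auction_inv_def)
    then have "own j - 1 < n" using assms(2) by auto
    then have "w (own j - 1) j \<le> C" using assms(3) j by blast
    moreover have "p j \<le> w (own j - 1) j + 1"
      using assms(1) j False by (auto simp: auction_inv_def)
    ultimately show ?thesis by simp
  qed (use assms(1) j in \<open>simp add: auction_inv_def\<close>)
  then have "(\<Sum>j<n. p j) \<le> (\<Sum>j<n. C + 1)" by (intro sum_mono) auto
  then show ?thesis by simp
qed

lemma auction_bij:
  assumes "auction_inv n w {..<n} p own"
  shows "bij_betw (\<lambda>j. own j - 1) {..<n} {..<n}" and "\<And>j. j < n \<Longrightarrow> own j \<noteq> 0"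
proof -
  let ?D = "{j. j < n \<and> own j \<noteq> 0}"
  have inj: "inj_on own ?D" and im: "own ` ?D = Suc ` {..<n}"
    using assms by (auto simp: auction_inv_def)
  have "card ?D = card (Suc ` {..<n})" using card_image[OF inj] im by simp
  then have "card ?D = n" by (simp add: card_image)
  then have D: "?D = {..<n}" by (intro card_subset_eq) auto
  then show nz: "\<And>j. j < n \<Longrightarrow> own j \<noteq> 0" by auto
  have "own ` {..<n} = Suc ` {..<n}" using im by (simp only: D)
  then have "(\<lambda>k. k - 1) ` own ` {..<n} = (\<lambda>k. k - 1) ` Suc ` {..<n}" by (rule arg_cong)
  then have "(\<lambda>j. own j - 1) ` {..<n} = {..<n}" by (simp add: image_image del: One_nat_def)
  then show "bij_betw (\<lambda>j. own j - 1) {..<n} {..<n}"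
    by (simp add: bij_betw_def eq_card_imp_inj_on)
qed

text \<open>Linear programming duality: prices and profits bound the weight of every matching.\<close>
lemma auction_near_optimal:
  assumes inv: "auction_inv n w {..<n} p own"
    and M: "M \<subseteq> {..<n} \<times> {..<n}" "inj_on fst M" "inj_on snd M"
  shows "(\<Sum>e\<in>M. w (fst e) (snd e)) \<le> (\<Sum>j<n. w (own j - 1) j) + n"
proof -
  define g where "g j = own j - 1" for j
  have bij: "bij_betw g {..<n} {..<n}" and nz: "\<And>j. j < n \<Longrightarrow> own j \<noteq> 0"
    using auction_bij[OF inv] by (auto simp: g_def[abs_def])
  define \<sigma> where "\<sigma> = inv_into {..<n} g"
  have \<sigma>g: "\<sigma> (g j) = j" if "j < n" for j
    unfolding \<sigma>_def using bij_betw_inv_into_left[OF bij] that by simp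
  have \<sigma>: "\<sigma> i < n" "g (\<sigma> i) = i" if "i < n" for i
    using bij that bij_betw_inv_into_right[OF bij, of i] bij_betwE[OF bij_betw_inv_into[OF bij]]
    by (auto simp: \<sigma>_def)
  \<comment> \<open>The dual variable of agent \<open>i\<close>: its profit plus 1. The 1 absorbs
    the error in the invariant, makes the truncated subtraction exact, and adds up to the slack
    \<open>n\<close> over all agents.\<close>
  define f where "f i = w i (\<sigma> i) + 1 - p (\<sigma> i)" for i
  have le: "w i k \<le> f i + p k" if "i < n" "k < n" for i k
  proof -
    have "p (\<sigma> i) \<le> w i (\<sigma> i) + 1" "w i k + p (\<sigma> i) \<le> w i (\<sigma> i) + p k + 1"
      using inv \<sigma>[OF that(1)] nz that by (auto simp: auction_inv_def g_def)
    then show ?thesis by (simp add: f_def)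
  qed
  have fin: "finite M" using M(1) by (rule finite_subset) simp
  have "(\<Sum>e\<in>M. w (fst e) (snd e)) \<le> (\<Sum>e\<in>M. f (fst e) + p (snd e))"
    using M(1) le by (intro sum_mono) auto
  also have "\<dots> = sum f (fst ` M) + sum p (snd ` M)"
    using M by (simp add: sum.distrib sum.reindex)
  also have "\<dots> \<le> sum f {..<n} + sum p {..<n}"
    using M(1) by (intro add_mono sum_mono2) auto
  also have "sum f {..<n} = (\<Sum>j<n. f (g j))"
    using sum.reindex_bij_betw[OF bij, of f] by simp
  also have "\<dots> + sum p {..<n} = (\<Sum>j<n. f (g j) + p j)" by (simp add: sum.distrib)
  also have "\<dots> = (\<Sum>j<n. w (g j) j + 1)"
  proof (rule sum.cong[OF refl])
    fix j assume "j \<in> {..<n}"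
    then show "f (g j) + p j = w (g j) j + 1"
      using inv nz \<sigma>g by (auto simp: f_def auction_inv_def g_def)
  qed
  also have "\<dots> = (\<Sum>j<n. w (own j - 1) j) + n" unfolding sum.distrib g_def by simp
  finally show ?thesis .
qed

text \<open>Among pairs of an agent and a bundle, positive weight characterizes the edges of
  \<open>G\<close>, so the test \<open>0 < w (own j - 1) j\<close> discards the padding of the
  assignment without changing its weight.\<close>

lemma auction_matching_c:
  assumes G: "G \<subseteq> {..<n} \<times> {..<n}" and K: "n < K" and T: "finite T" "matching_a G T M\<^sub>a"
    and w: "\<And>i j. i < n \<Longrightarrow> j < n \<Longrightarrow> w i j = edge_weight K T G (i, j)"
    and inv: "auction_inv n w {..<n} p own"
  shows "matching_c G T {(own j - 1, j) | j. j < n \<and> 0 < w (own j - 1) j}"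
proof -
  define M where "M = {(own j - 1, j) | j. j < n \<and> 0 < w (own j - 1) j}"
  note bij = auction_bij(1)[OF inv]
  have ownn: "own j - 1 < n" if "j < n" for j using bij_betwE[OF bij] that by auto
  have edge: "(own j - 1, j) \<in> G" if "j < n" "0 < w (own j - 1) j" for j
    using that w[OF ownn[OF that(1)] that(1)] by (auto simp: edge_weight_def split: if_splits)
  have MG: "matching G M"
    using edge bij unfolding matching_def M_def bij_betw_def inj_on_def by auto
  have fin: "finite M" using MG G unfolding matching_def by (meson finite_SigmaI finite_lessThan finite_subset)
  have eq: "(\<Sum>e\<in>N. w (fst e) (snd e)) = sum (edge_weight K T G) N" if "matching G N" for N
    using that G w by (intro sum.cong) (auto simp: matching_def)
  have "matching_c G T M"
  proof (rule near_max_weight_matching_c[OF G MG K T])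
    fix M' assume M': "matching G M'"
    have "sum (edge_weight K T G) M' \<le> (\<Sum>j<n. w (own j - 1) j) + n"
      unfolding eq[OF M', symmetric]
      by (rule auction_near_optimal[OF inv]) (use M' G in \<open>auto simp: matching_def\<close>)
    also have "(\<Sum>j<n. w (own j - 1) j) = (\<Sum>j\<in>{j. j < n \<and> 0 < w (own j - 1) j}. w (own j - 1) j)"
      by (rule sum.mono_neutral_right) auto
    also have "\<dots> = (\<Sum>e\<in>(\<lambda>j. (own j - 1, j)) ` {j. j < n \<and> 0 < w (own j - 1) j}. w (fst e) (snd e))"
      by (subst sum.reindex) (auto simp: inj_on_def)
    also have "(\<lambda>j. (own j - 1, j)) ` {j. j < n \<and> 0 < w (own j - 1) j} = M"
      by (auto simp: M_def)
    also have "(\<Sum>e\<in>M. w (fst e) (snd e)) = sum (edge_weight K T G) M" by (rule eq[OF MG])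
    finally show "sum (edge_weight K T G) M' \<le> sum (edge_weight K T G) M + n" .
  qed
  then show ?thesis by (simp add: M_def)
qed

section \<open>Time-bounded execution\<close>

text \<open>The cost of a program all of whose loops make at most \<open>H\<close> iterations each time they are run.\<close>
primrec cost :: "nat \<Rightarrow> com \<Rightarrow> nat" where
  "cost H Skip = 1"
| "cost H (NAssign x es a) = 1"
| "cost H (RAssign x es a) = 1"
| "cost H (Seq c d) = cost H c + cost H d"
| "cost H (Cond b c d) = 1 + cost H c + cost H d"
| "cost H (While b c) = H * (1 + cost H c) + 1"

text \<open>The degree is the nesting depth of the loops, which is fixed by the program.\<close>

primrec cost_poly :: "com \<Rightarrow> nat poly" where
  "cost_poly Skip = 1"
| "cost_poly (NAssign x es a) = 1"
| "cost_poly (RAssign x es a) = 1"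
| "cost_poly (Seq c d) = cost_poly c + cost_poly d"
| "cost_poly (Cond b c d) = 1 + cost_poly c + cost_poly d"
| "cost_poly (While b c) = [:0, 1:] * (1 + cost_poly c) + 1"

lemma poly_cost_poly: "poly (cost_poly c) H = cost H c"
  by (induction c) auto

primrec nat_writes :: "com \<Rightarrow> string set" where
  "nat_writes Skip = {}"
| "nat_writes (NAssign x es a) = {x}"
| "nat_writes (RAssign x es a) = {}"
| "nat_writes (Seq c d) = nat_writes c \<union> nat_writes d"
| "nat_writes (Cond b c d) = nat_writes c \<union> nat_writes d"
| "nat_writes (While b c) = nat_writes c"

primrec real_writes :: "com \<Rightarrow> string set" where
  "real_writes Skip = {}"
| "real_writes (NAssign x es a) = {}"
| "real_writes (RAssign x es a) = {x}"
| "real_writes (Seq c d) = real_writes c \<union> real_writes d"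
| "real_writes (Cond b c d) = real_writes c \<union> real_writes d"
| "real_writes (While b c) = real_writes c"

text \<open>The frame condition, tracked per array name rather than per cell.\<close>

definition agree_off :: "string set \<Rightarrow> string set \<Rightarrow> state \<Rightarrow> state \<Rightarrow> bool" where
  "agree_off A B s s' \<longleftrightarrow>
     (\<forall>x. x \<notin> A \<longrightarrow> fst s' x = fst s x) \<and> (\<forall>x. x \<notin> B \<longrightarrow> snd s' x = snd s x)"

lemma agree_off_refl [simp]: "agree_off A B s s"
  by (simp add: agree_off_def)

lemma agree_off_trans:
  "agree_off A B s s' \<Longrightarrow> agree_off A' B' s' s'' \<Longrightarrow> A \<subseteq> C \<Longrightarrow> A' \<subseteq> C \<Longrightarrow> B \<subseteq> D \<Longrightarrow> B' \<subseteq> D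
    \<Longrightarrow> agree_off C D s s''"
  unfolding agree_off_def by (metis subsetD)

lemma exec_agree_off: "exec c s t s' \<Longrightarrow> agree_off (nat_writes c) (real_writes c) s s'"
proof (induction rule: exec.induct)
  case (WhileTrue s b c t s' u s'')
  then show ?case by (auto elim: agree_off_trans)
qed (auto simp: agree_off_def nupdate_def rupdate_def)

text \<open>Total correctness with a built-in time bound. As \<open>cost H c\<close> does not depend
  on the state, the bounds compose along the syntax and proofs about concrete programs need no time
  arithmetic.\<close>

definition runs :: "nat \<Rightarrow> com \<Rightarrow> state \<Rightarrow> (state \<Rightarrow> bool) \<Rightarrow> bool" where
  "runs H c s Q \<longleftrightarrow> (\<exists>t s'. exec c s t s' \<and> t \<le> cost H c \<and> Q s')"

lemma runs_weaken:
  assumes "runs H c s Q"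
    and "\<And>s'. Q s' \<Longrightarrow> agree_off (nat_writes c) (real_writes c) s s' \<Longrightarrow> Q' s'"
  shows "runs H c s Q'"
  using assms exec_agree_off unfolding runs_def by meson

lemma runs_Seq:
  assumes "runs H c s Q"
    and "\<And>s'. Q s' \<Longrightarrow> agree_off (nat_writes c) (real_writes c) s s' \<Longrightarrow> runs H d s' Q'"
  shows "runs H (Seq c d) s Q'"
proof -
  obtain t s' where 1: "exec c s t s'" "t \<le> cost H c" "Q s'" using assms(1) by (auto simp: runs_def)
  then obtain u s'' where 2: "exec d s' u s''" "u \<le> cost H d" "Q' s''"
    using assms(2) exec_agree_off unfolding runs_def by meson
  have "exec (Seq c d) s (t + u) s''" using 1 2 by (intro exec.Seq)
  moreover have "t + u \<le> cost H (Seq c d)" using 1 2 by simp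
  ultimately show ?thesis using 2(3) unfolding runs_def by blast
qed

lemma runs_Cond:
  assumes "bval s b \<Longrightarrow> runs H c s Q" and "\<not> bval s b \<Longrightarrow> runs H d s Q"
  shows "runs H (Cond b c d) s Q"
proof (cases "bval s b")
  case True
  then obtain t s' where "exec c s t s'" "t \<le> cost H c" "Q s'" using assms by (auto simp: runs_def)
  moreover from this have "exec (Cond b c d) s (1 + t) s'" using True by (intro exec.CondTrue)
  ultimately show ?thesis unfolding runs_def by fastforce
next
  case False
  then obtain t s' where "exec d s t s'" "t \<le> cost H d" "Q s'" using assms by (auto simp: runs_def)
  moreover from this have "exec (Cond b c d) s (1 + t) s'" using False by (intro exec.CondFalse)
  ultimately show ?thesis unfolding runs_def by fastforce
qed

text \<open>The initial value of the variant \<open>f\<close> bounds the number of iterations. It is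
  compared with \<open>H\<close> only once, at the start, and the induction counts time in terms of
  \<open>f\<close>.\<close>

lemma runs_While:
  assumes "I s" and "f s \<le> H"
    and step: "\<And>s'. I s' \<Longrightarrow> bval s' b \<Longrightarrow> agree_off (nat_writes c) (real_writes c) s s' \<Longrightarrow>
      runs H c s' (\<lambda>s''. I s'' \<and> f s'' < f s')"
    and final: "\<And>s'. I s' \<Longrightarrow> \<not> bval s' b \<Longrightarrow> agree_off (nat_writes c) (real_writes c) s s' \<Longrightarrow> Q s'"
  shows "runs H (While b c) s Q"
proof -
  have "\<exists>t r. exec (While b c) s' t r \<and> t \<le> f s' * (1 + cost H c) + 1 \<and> Q r"
    if "I s'" "agree_off (nat_writes c) (real_writes c) s s'" for s'
    using that
  proof (induction "f s'" arbitrary: s' rule: less_induct)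
    case less
    show ?case
    proof (cases "bval s' b")
      case True
      obtain t r where r: "exec c s' t r" "t \<le> cost H c" "I r" "f r < f s'"
        using step[OF less.prems(1) True less.prems(2)] by (auto simp: runs_def)
      have "agree_off (nat_writes c) (real_writes c) s r"
        using agree_off_trans[OF less.prems(2) exec_agree_off[OF r(1)]] by blast
      from less.hyps[OF r(4,3) this] obtain u q where
        q: "exec (While b c) r u q" "u \<le> f r * (1 + cost H c) + 1" "Q q" by blast
      have "Suc (f r) * (1 + cost H c) \<le> f s' * (1 + cost H c)"
        using r(4) by (intro mult_right_mono) auto
      then have "1 + t + u \<le> f s' * (1 + cost H c) + 1" using r(2) q(2) by simp
      moreover have "exec (While b c) s' (1 + t + u) q" using True r q by (intro exec.WhileTrue)
      ultimately show ?thesis using q(3) by blast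
    next
      case False
      then show ?thesis using final less.prems exec.WhileFalse[OF False] by fastforce
    qed
  qed
  from this[OF assms(1) agree_off_refl] obtain t r where
    r: "exec (While b c) s t r" "t \<le> f s * (1 + cost H c) + 1" "Q r" by blast
  have "f s * (1 + cost H c) \<le> H * (1 + cost H c)" using assms(2) by (intro mult_right_mono) auto
  then have "t \<le> cost H (While b c)" using r(2) by simp
  then show ?thesis using r unfolding runs_def by blast
qed

primrec straight_line :: "com \<Rightarrow> bool" where
  "straight_line Skip \<longleftrightarrow> True"
| "straight_line (NAssign x es a) \<longleftrightarrow> True"
| "straight_line (RAssign x es a) \<longleftrightarrow> True"
| "straight_line (Seq c d) \<longleftrightarrow> straight_line c \<and> straight_line d"
| "straight_line (Cond b c d) \<longleftrightarrow> straight_line c \<and> straight_line d"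
| "straight_line (While b c) \<longleftrightarrow> False"

text \<open>Symbolic execution of loop-free code by simplification; the clause for
  \<open>While\<close> is a dummy that \<open>straight_line\<close> rules out.\<close>

primrec result :: "com \<Rightarrow> state \<Rightarrow> state" where
  "result Skip s = s"
| "result (NAssign x es a) s = nupdate x es a s"
| "result (RAssign x es a) s = rupdate x es a s"
| "result (Seq c d) s = result d (result c s)"
| "result (Cond b c d) s = (if bval s b then result c s else result d s)"
| "result (While b c) s = s"

lemma runs_straight_line:
  assumes "straight_line c" and "Q (result c s)"
  shows "runs H c s Q"
  using assms
proof (induction c arbitrary: s Q)
  case Skip
  then show ?case using exec.Skip[of s] by (force simp: runs_def simp del: split_paired_Ex)
next
  case (NAssign x es a)
  then show ?case using exec.NAssign[of x es a s] by (force simp: runs_def simp del: split_paired_Ex)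
next
  case (RAssign x es a)
  then show ?case using exec.RAssign[of x es a s] by (force simp: runs_def simp del: split_paired_Ex)
next
  case (Seq c d)
  have "runs H c s (\<lambda>s'. s' = result c s)" by (rule Seq.IH(1)) (use Seq.prems in auto)
  then show ?case by (rule runs_Seq) (use Seq in auto)
next
  case (Cond b c d)
  show ?case
  proof (rule runs_Cond)
    show "runs H c s Q" if "bval s b" using Cond.prems that by (intro Cond.IH(1)) auto
    show "runs H d s Q" if "\<not> bval s b" using Cond.prems that by (intro Cond.IH(2)) auto
  qed
qed simp

lemma nupdate_pair [simp]:
  "nupdate x es a (N, R) = (N(x := (N x)(map (nval N) es := nval N a)), R)"
  by (simp add: nupdate_def)

lemma rupdate_pair [simp]:
  "rupdate x es a (N, R) = (N, R(x := (R x)(map (nval N) es := rval (N, R) a)))"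
  by (simp add: rupdate_def)

abbreviation "nvar x \<equiv> NVar x []"
abbreviation "increment x \<equiv> NAssign x [] (NAdd (nvar x) (NConst 1))"

definition For :: "string \<Rightarrow> string \<Rightarrow> com \<Rightarrow> com" where
  "For x y c = Seq (NAssign x [] (NConst 0)) (While (NLess (nvar x) (nvar y)) (Seq c (increment x)))"

lemma For_writes [simp]:
  "nat_writes (For x y c) = insert x (nat_writes c)"
  "real_writes (For x y c) = real_writes c"
  by (auto simp: For_def)

lemma not_straight_line_For [simp]: "\<not> straight_line (For x y c)"
  by (simp add: For_def)

text \<open>The invariant receives the number of completed iterations as an argument, and
  \<open>counter\<close> makes it stable under writes to the loop variable. Initializing and
  incrementing that variable are thus handled here once and for all.\<close>

lemma runs_For:
  assumes x: "x \<notin> nat_writes c" and y: "y \<notin> nat_writes c" "x \<noteq> y"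
    and h: "fst s y [] = h" "h \<le> H"
    and counter: "\<And>k N R a. I k N R \<Longrightarrow> I k (N(x := a)) R"
    and init: "I 0 (fst s) (snd s)"
    and step: "\<And>k N R. k < h \<Longrightarrow> agree_off (insert x (nat_writes c)) (real_writes c) s (N, R) \<Longrightarrow>
      N x [] = k \<Longrightarrow> I k N R \<Longrightarrow> runs H c (N, R) (\<lambda>s'. I (Suc k) (fst s') (snd s'))"
    and final: "\<And>N R. I h N R \<Longrightarrow> agree_off (insert x (nat_writes c)) (real_writes c) s (N, R) \<Longrightarrow> Q (N, R)"
  shows "runs H (For x y c) s Q"
  unfolding For_def
proof (rule runs_Seq[where Q = "\<lambda>s'. s' = nupdate x [] (NConst 0) s"])
  show "runs H (NAssign x [] (NConst 0)) s (\<lambda>s'. s' = nupdate x [] (NConst 0) s)"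
    by (rule runs_straight_line) auto
next
  fix s' assume s': "s' = nupdate x [] (NConst 0) s"
  let ?A = "insert x (nat_writes c)" and ?B = "real_writes c"
  let ?c = "Seq c (increment x)"
  have ss': "agree_off ?A ?B s s'" by (cases s) (simp add: s' agree_off_def)
  have off: "agree_off ?A ?B s r" if "agree_off (nat_writes ?c) (real_writes ?c) s' r" for r
    using agree_off_trans[OF ss' that, of ?A ?B] by auto
  have yh: "fst r y [] = h" if "agree_off ?A ?B s r" for r
    using that y h by (auto simp: agree_off_def)
  show "runs H (While (NLess (nvar x) (nvar y)) ?c) s' Q"
  proof (rule runs_While[where I = "\<lambda>r. fst r x [] \<le> h \<and> I (fst r x []) (fst r) (snd r)"
        and f = "\<lambda>r. h - fst r x []"])
    show "fst s' x [] \<le> h \<and> I (fst s' x []) (fst s') (snd s')"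
      using counter[OF init] by (cases s) (simp add: s')
    show "h - fst s' x [] \<le> H" using h(2) by simp
  next
    fix r assume I: "fst r x [] \<le> h \<and> I (fst r x []) (fst r) (snd r)"
      and b: "bval r (NLess (nvar x) (nvar y))"
      and "agree_off (nat_writes ?c) (real_writes ?c) s' r"
    then have o: "agree_off ?A ?B s r" using off by blast
    define k where "k = fst r x []"
    have k: "k < h" using b yh[OF o] by (simp add: k_def)
    obtain N R where r: "r = (N, R)" by (cases r)
    have body: "runs H c r (\<lambda>s'. I (Suc k) (fst s') (snd s'))"
      using step[OF k o[unfolded r]] I by (simp add: k_def r)
    show "runs H ?c r (\<lambda>q. (fst q x [] \<le> h \<and> I (fst q x []) (fst q) (snd q)) \<and> h - fst q x [] < h - fst r x [])"
    proof (rule runs_Seq[OF body])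
      fix q assume Iq: "I (Suc k) (fst q) (snd q)" and oq: "agree_off (nat_writes c) (real_writes c) r q"
      have qx: "fst q x [] = k" using oq x by (simp add: agree_off_def k_def)
      show "runs H (increment x) q
          (\<lambda>q. (fst q x [] \<le> h \<and> I (fst q x []) (fst q) (snd q)) \<and> h - fst q x [] < h - fst r x [])"
        by (rule runs_straight_line, simp, cases q)
          (use k qx counter[OF Iq] in \<open>auto simp: k_def[symmetric]\<close>)
    qed
  next
    fix r assume I: "fst r x [] \<le> h \<and> I (fst r x []) (fst r) (snd r)"
      and b: "\<not> bval r (NLess (nvar x) (nvar y))"
      and "agree_off (nat_writes ?c) (real_writes ?c) s' r"
    then have o: "agree_off ?A ?B s r" using off by blast
    have "fst r x [] = h" using I b yh[OF o] by simp
    then show "Q r" using I final[of "fst r" "snd r"] o by simp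
  qed
qed

text \<open>For loops that fill a matrix: the body has to establish \<open>P\<close> for its own
  cell and preserve it for all other cells.\<close>

lemma runs_For2:
  assumes x: "x \<notin> nat_writes c" "x \<noteq> y" "x \<noteq> u" "x \<noteq> w" and y: "y \<notin> nat_writes c" "y \<noteq> u" "y \<noteq> w"
    and u: "u \<notin> nat_writes c" "fst s u [] = h" "h \<le> H"
    and w: "w \<notin> nat_writes c" "fst s w [] = l" "l \<le> H"
    and counters: "\<And>i k N R a. P i k (N(x := a)) R = P i k N R" "\<And>i k N R a. P i k (N(y := a)) R = P i k N R"
    and cell: "\<And>i k N R. i < h \<Longrightarrow> k < l \<Longrightarrow>
      agree_off (insert x (insert y (nat_writes c))) (real_writes c) s (N, R) \<Longrightarrow>
      N x [] = i \<Longrightarrow> N y [] = k \<Longrightarrow>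
      runs H c (N, R) (\<lambda>s'. P i k (fst s') (snd s') \<and>
        (\<forall>i' k'. (i', k') \<noteq> (i, k) \<longrightarrow> P i' k' N R \<longrightarrow> P i' k' (fst s') (snd s')))"
    and final: "\<And>N R. \<forall>i<h. \<forall>k<l. P i k N R \<Longrightarrow>
      agree_off (insert x (insert y (nat_writes c))) (real_writes c) s (N, R) \<Longrightarrow> Q (N, R)"
  shows "runs H (For x u (For y w c)) s Q"
proof (rule runs_For[where h = h and I = "\<lambda>a N R. \<forall>i<a. \<forall>k<l. P i k N R"])
  fix a N R
  assume a: "a < h" and o: "agree_off (insert x (nat_writes (For y w c))) (real_writes (For y w c)) s (N, R)"
    and Nx: "N x [] = a" and I: "\<forall>i<a. \<forall>k<l. P i k N R"
  show "runs H (For y w c) (N, R) (\<lambda>s'. \<forall>i<Suc a. \<forall>k<l. P i k (fst s') (snd s'))"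
  proof (rule runs_For[where h = l
        and I = "\<lambda>b N R. (\<forall>i<a. \<forall>k<l. P i k N R) \<and> (\<forall>k<b. P a k N R)"])
    fix b N' R'
    assume b: "b < l" and o': "agree_off (insert y (nat_writes c)) (real_writes c) (N, R) (N', R')"
      and Ny: "N' y [] = b" and I': "(\<forall>i<a. \<forall>k<l. P i k N' R') \<and> (\<forall>k<b. P a k N' R')"
    have oo: "agree_off (insert x (insert y (nat_writes c))) (real_writes c) s (N', R')"
      using agree_off_trans[OF o o', of "insert x (insert y (nat_writes c))" "real_writes c"] by auto
    have Nx': "N' x [] = a" using o' Nx x by (auto simp: agree_off_def)
    show "runs H c (N', R') (\<lambda>s'. (\<forall>i<a. \<forall>k<l. P i k (fst s') (snd s')) \<and> (\<forall>k<Suc b. P a k (fst s') (snd s')))"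
      by (rule runs_weaken[OF cell[OF a b oo Nx' Ny]]) (use I' in \<open>auto simp: less_Suc_eq\<close>)
  next
    show "fst (N, R) w [] = l" using o w x y by (auto simp: agree_off_def)
  qed (use y w I counters in \<open>auto simp: less_Suc_eq\<close>)
next
  show "Q (N, R)" if "\<forall>i<h. \<forall>k<l. P i k N R"
    "agree_off (insert x (nat_writes (For y w c))) (real_writes (For y w c)) s (N, R)" for N R
    using that final[of N R] by simp
qed (use x y u counters in auto)

section \<open>The parts of the program\<close>

lemma runs_Seq_straight_line:
  assumes "straight_line c" and "runs H d (result c s) Q"
  shows "runs H (Seq c d) s Q"
  by (rule runs_Seq[where Q = "\<lambda>s'. s' = result c s"])
    (use assms in \<open>auto intro: runs_straight_line\<close>)

abbreviation "nmat x a b \<equiv> NVar x [nvar a, nvar b]"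
abbreviation "rmat x a b \<equiv> RVar x [nvar a, nvar b]"
abbreviation "nonzero a \<equiv> NLess (NConst 0) a"
abbreviation "equal_vars x y \<equiv> BAnd (BNot (NLess (nvar x) (nvar y))) (BNot (NLess (nvar y) (nvar x)))"

text \<open>
  Memory layout: \<open>s\<close> and \<open>q\<close> hold the values of the bundles without and with the removal of a
  least valuable item, \<open>d\<close> the robust demands, \<open>w\<close> the edge weights, \<open>p\<close> and \<open>o\<close> the prices and
  owners of the auction, \<open>u\<close> the bidder and \<open>l\<close> the bundle it bids for, \<open>t\<close> the touched flags.  The
  current family \<open>Z\<close> overwrites the input in \<open>x\<close>.
\<close>

definition bundle_values :: com where
  "bundle_values =
     For ''i'' ''n'' (For ''k'' ''n''
       (Seq (RAssign ''s'' [nvar ''i'', nvar ''k''] RZero)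
         (For ''g'' ''m''
           (Cond (nonzero (nmat ''x'' ''k'' ''g''))
             (RAssign ''s'' [nvar ''i'', nvar ''k'']
               (RAdd (rmat ''s'' ''i'' ''k'') (rmat ''v'' ''i'' ''g'')))
             Skip))))"

lemma bundle_values_writes [simp]:
  "nat_writes bundle_values = {''i'', ''k'', ''g''}" "real_writes bundle_values = {''s''}"
  by (auto simp: bundle_values_def)

lemma runs_bundle_values:
  assumes n: "N ''n'' [] = n" "n \<le> H" and m: "N ''m'' [] = m" "m \<le> H"
  shows "runs H bundle_values (N, R) (\<lambda>s'. \<forall>i<n. \<forall>k<n. snd s' ''s'' [i, k] =
    (\<Sum>g<m. if N ''x'' [k, g] = 0 then 0 else R ''v'' [i, g]))"
proof -
  define F where "F i k m = (\<Sum>g<m. if N ''x'' [k, g] = 0 then 0 else R ''v'' [i, g])" for i k and m :: nat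
  show ?thesis
    unfolding bundle_values_def F_def[symmetric]
  proof (rule runs_For2[where h = n and l = n and P = "\<lambda>i k N R. R ''s'' [i, k] = F i k m"], goal_cases)
    case (16 i k N' R')
    show ?case
    proof (intro runs_Seq_straight_line runs_For[where h = m
          and I = "\<lambda>g N'' R''. R'' = R'(''s'' := (R' ''s'')([i, k] := F i k g))"], goal_cases)
      case (9 g N'' R'')
      then show ?case using 16
        by (intro runs_straight_line) (auto simp: agree_off_def F_def)
    qed (use 16 m in \<open>auto simp: agree_off_def F_def\<close>)
  qed (use n in auto)
qed

text \<open>The start value 0 is also what \<open>max_minus_one\<close> assigns to an empty
  bundle.\<close>

primrec partial_max :: "(nat \<Rightarrow> bool) \<Rightarrow> (nat \<Rightarrow> real) \<Rightarrow> nat \<Rightarrow> real" where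
  "partial_max P f 0 = 0"
| "partial_max P f (Suc g) =
     (if P g \<and> partial_max P f g < f g then f g else partial_max P f g)"

definition robust_values :: com where
  "robust_values =
     For ''i'' ''n'' (For ''k'' ''n''
       (Seq (RAssign ''q'' [nvar ''i'', nvar ''k''] RZero)
         (For ''g'' ''m''
           (Cond (BAnd (nonzero (nmat ''x'' ''k'' ''g''))
                   (RLess (rmat ''q'' ''i'' ''k'') (RSub (rmat ''s'' ''i'' ''k'') (rmat ''v'' ''i'' ''g''))))
             (RAssign ''q'' [nvar ''i'', nvar ''k'']
               (RSub (rmat ''s'' ''i'' ''k'') (rmat ''v'' ''i'' ''g'')))
             Skip))))"

lemma robust_values_writes [simp]:
  "nat_writes robust_values = {''i'', ''k'', ''g''}" "real_writes robust_values = {''q''}"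
  by (auto simp: robust_values_def)

lemma runs_robust_values:
  assumes n: "N ''n'' [] = n" "n \<le> H" and m: "N ''m'' [] = m" "m \<le> H"
  shows "runs H robust_values (N, R) (\<lambda>s'. \<forall>i<n. \<forall>k<n. snd s' ''q'' [i, k] =
    partial_max (\<lambda>g. N ''x'' [k, g] \<noteq> 0) (\<lambda>g. R ''s'' [i, k] - R ''v'' [i, g]) m)"
proof -
  define F where "F i k = partial_max (\<lambda>g. N ''x'' [k, g] \<noteq> 0) (\<lambda>g. R ''s'' [i, k] - R ''v'' [i, g])" for i k
  show ?thesis
    unfolding robust_values_def F_def[symmetric]
  proof (rule runs_For2[where h = n and l = n and P = "\<lambda>i k N R. R ''q'' [i, k] = F i k m"], goal_cases)
    case (16 i k N' R')
    show ?case
    proof (intro runs_Seq_straight_line runs_For[where h = m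
          and I = "\<lambda>g N'' R''. R'' = R'(''q'' := (R' ''q'')([i, k] := F i k g))"], goal_cases)
      case (9 g N'' R'')
      then show ?case using 16
        by (intro runs_straight_line) (auto simp: agree_off_def F_def)
    qed (use 16 m in \<open>auto simp: agree_off_def F_def\<close>)
  qed (use n in auto)
qed

definition robust_demands :: com where
  "robust_demands =
     For ''i'' ''n''
       (Seq (NAssign ''d'' [nvar ''i''] (NConst 0))
         (For ''k'' ''n''
           (Cond (RLess (RVar ''q'' [nvar ''i'', NVar ''d'' [nvar ''i'']]) (rmat ''q'' ''i'' ''k''))
             (NAssign ''d'' [nvar ''i''] (nvar ''k''))
             Skip)))"

lemma robust_demands_writes [simp]:
  "nat_writes robust_demands = {''i'', ''k'', ''d''}" "real_writes robust_demands = {}"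
  by (auto simp: robust_demands_def)

lemma runs_robust_demands:
  assumes n: "N ''n'' [] = n" "n \<le> H" "0 < n"
  shows "runs H robust_demands (N, R) (\<lambda>s'. \<forall>i<n. fst s' ''d'' [i] < n \<and>
    (\<forall>k<n. R ''q'' [i, k] \<le> R ''q'' [i, fst s' ''d'' [i]]))"
proof -
  define P where "P h i N' \<longleftrightarrow> N' ''d'' [i] < n \<and> (\<forall>k<h. R ''q'' [i, k] \<le> R ''q'' [i, N' ''d'' [i]])"
    for h i :: nat and N' :: nstore
  show ?thesis
    unfolding robust_demands_def P_def[symmetric]
  proof (rule runs_For[where h = n and I = "\<lambda>i N R. \<forall>i'<i. P n i' N"], goal_cases)
    case (8 i N' R')
    show ?case
    proof (intro runs_Seq_straight_line runs_For[where h = n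
          and I = "\<lambda>k N'' R''. (\<forall>i'<i. P n i' N'') \<and> P k i N''"], goal_cases)
      case (9 k N'' R'')
      then have eq: "N'' ''i'' [] = i" "R'' = R"
        using \<open>agree_off _ _ (N, R) (N', R')\<close> \<open>N' ''i'' [] = i\<close> by (auto simp: agree_off_def)
      have "R ''q'' [i, k'] \<le> R ''q'' [i, k]"
        if "R ''q'' [i, N'' ''d'' [i]] < R ''q'' [i, k]" "k' < k" for k'
        using 9 that by (force simp: P_def)
      then show ?case using 9
        by (intro runs_Cond runs_straight_line) (simp_all add: eq P_def less_Suc_eq_le le_less not_less)
    qed (use 8 n in \<open>auto simp: agree_off_def P_def less_Suc_eq\<close>)
  qed (use n in \<open>auto simp: P_def\<close>)
qed

text \<open>EFX feasibility is tested against the robust demand alone, because that bundle attains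
  the largest of all thresholds. The scalars \<open>a\<close>, \<open>b\<close> and \<open>c\<close>
  will hold the first three powers of \<open>n + 1\<close>.\<close>

definition edge_weights :: com where
  "edge_weights =
     For ''i'' ''n'' (For ''k'' ''n''
       (Cond (BAnd (BNot (RLess (rmat ''s'' ''i'' ''k'') (RVar ''q'' [nvar ''i'', NVar ''d'' [nvar ''i'']])))
               (BNot (BAnd (BNot (equal_vars ''i'' ''k''))
                 (BNot (RLess (rmat ''s'' ''i'' ''i'') (rmat ''s'' ''i'' ''k''))))))
         (Seq (NAssign ''w'' [nvar ''i'', nvar ''k''] (nvar ''a''))
           (Seq (Cond (equal_vars ''i'' ''k'')
               (NAssign ''w'' [nvar ''i'', nvar ''k''] (NAdd (nmat ''w'' ''i'' ''k'') (nvar ''b''))) Skip)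
             (Cond (nonzero (NVar ''t'' [nvar ''k'']))
               (NAssign ''w'' [nvar ''i'', nvar ''k''] (NAdd (nmat ''w'' ''i'' ''k'') (nvar ''c''))) Skip)))
         (NAssign ''w'' [nvar ''i'', nvar ''k''] (NConst 0))))"

lemma edge_weights_writes [simp]:
  "nat_writes edge_weights = {''i'', ''k'', ''w''}" "real_writes edge_weights = {}"
  by (auto simp: edge_weights_def)

lemma runs_edge_weights:
  assumes n: "N ''n'' [] = n" "n \<le> H"
  shows "runs H edge_weights (N, R) (\<lambda>s'. \<forall>i<n. \<forall>k<n. fst s' ''w'' [i, k] =
    (if R ''q'' [i, N ''d'' [i]] \<le> R ''s'' [i, k] \<and> (i \<noteq> k \<longrightarrow> R ''s'' [i, i] < R ''s'' [i, k])
     then N ''a'' [] + (if i = k then N ''b'' [] else 0) + (if N ''t'' [k] \<noteq> 0 then N ''c'' [] else 0)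
     else 0))"
proof -
  define F where "F i k =
    (if R ''q'' [i, N ''d'' [i]] \<le> R ''s'' [i, k] \<and> (i \<noteq> k \<longrightarrow> R ''s'' [i, i] < R ''s'' [i, k])
     then N ''a'' [] + (if i = k then N ''b'' [] else 0) + (if N ''t'' [k] \<noteq> 0 then N ''c'' [] else 0)
     else 0)" for i k
  show ?thesis
    unfolding edge_weights_def F_def[symmetric]
  proof (rule runs_For2[where h = n and l = n and P = "\<lambda>i k N R. N ''w'' [i, k] = F i k"], goal_cases)
    case (16 i k N' R')
    then show ?case
      by (intro runs_straight_line) (auto simp: agree_off_def F_def)
  qed (use n in auto)
qed

text \<open>Profits are compared after moving prices to the other side, so that no truncated
  subtraction occurs.\<close>

definition best_bid :: com where
  "best_bid =
     Seq (NAssign ''l'' [] (NConst 0))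
       (For ''k'' ''n''
         (Cond (NLess (NAdd (nmat ''w'' ''u'' ''l'') (NVar ''p'' [nvar ''k'']))
                  (NAdd (nmat ''w'' ''u'' ''k'') (NVar ''p'' [nvar ''l''])))
           (NAssign ''l'' [] (nvar ''k''))
           Skip))"

lemma best_bid_writes [simp]: "nat_writes best_bid = {''k'', ''l''}" "real_writes best_bid = {}"
  by (auto simp: best_bid_def)

lemma runs_best_bid:
  assumes n: "N ''n'' [] = n" "n \<le> H" "0 < n" and u: "N ''u'' [] = u"
  shows "runs H best_bid (N, R) (\<lambda>s'. fst s' ''l'' [] < n \<and>
    (\<forall>k<n. N ''w'' [u, k] + N ''p'' [fst s' ''l'' []] \<le> N ''w'' [u, fst s' ''l'' []] + N ''p'' [k]))"
  unfolding best_bid_def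
proof (intro runs_Seq_straight_line runs_For[where h = n and I = "\<lambda>h N' R'. N' ''l'' [] < n \<and>
    (\<forall>k<h. N ''w'' [u, k] + N ''p'' [N' ''l'' []] \<le> N ''w'' [u, N' ''l'' []] + N ''p'' [k])"], goal_cases)
  case (9 k N' R')
  have "N ''w'' [u, k'] + N ''p'' [k] \<le> N ''w'' [u, k] + N ''p'' [k']"
    if "k' < k" "N ''w'' [u, N' ''l'' []] + N ''p'' [k] < N ''w'' [u, k] + N ''p'' [N' ''l'' []]" for k'
  proof -
    have "N ''w'' [u, k'] + N ''p'' [N' ''l'' []] \<le> N ''w'' [u, N' ''l'' []] + N ''p'' [k']"
      using 9 that(1) by blast
    then show ?thesis using that(2) by linarith
  qed
  then show ?case using 9 u
    by (intro runs_straight_line) (auto simp: agree_off_def less_Suc_eq not_less)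
qed (use n in auto)

text \<open>The scalar \<open>f\<close> saves the previous entry of \<open>o\<close>. If it is
  nonzero, the displaced agent \<open>f - 1\<close> bids next; if it is 0, the bundle was free and
  the phase ends.\<close>

definition auction_round :: com where
  "auction_round =
     Seq best_bid
       (Seq (NAssign ''p'' [nvar ''l''] (NAdd (NVar ''p'' [nvar ''l'']) (NConst 1)))
         (Seq (NAssign ''f'' [] (NVar ''o'' [nvar ''l'']))
           (Seq (NAssign ''o'' [nvar ''l''] (NAdd (nvar ''u'') (NConst 1)))
             (NAssign ''u'' [] (NSub (nvar ''f'') (NConst 1))))))"

lemma auction_round_writes [simp]:
  "nat_writes auction_round = {''k'', ''l'', ''p'', ''f'', ''o'', ''u''}" "real_writes auction_round = {}"
  by (auto simp: auction_round_def)

lemma runs_auction_round: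
  assumes n: "N ''n'' [] = n" "n \<le> H" "0 < n"
  shows "runs H auction_round (N, R) (\<lambda>s'. \<exists>l<n.
    (\<forall>k<n. N ''w'' [N ''u'' [], k] + N ''p'' [l] \<le> N ''w'' [N ''u'' [], l] + N ''p'' [k]) \<and>
    fst s' ''p'' = (N ''p'')([l] := Suc (N ''p'' [l])) \<and>
    fst s' ''o'' = (N ''o'')([l] := Suc (N ''u'' [])) \<and>
    fst s' ''f'' [] = N ''o'' [l] \<and> fst s' ''u'' [] = N ''o'' [l] - 1)"
  unfolding auction_round_def
proof (rule runs_Seq[OF runs_best_bid[where N = N and R = R, OF n refl]])
  fix s'
  assume l: "fst s' ''l'' [] < n \<and> (\<forall>k<n. N ''w'' [N ''u'' [], k] + N ''p'' [fst s' ''l'' []]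
      \<le> N ''w'' [N ''u'' [], fst s' ''l'' []] + N ''p'' [k])"
    and o: "agree_off (nat_writes best_bid) (real_writes best_bid) (N, R) s'"
  obtain N' R' where s': "s' = (N', R')" by (cases s')
  have eq: "N' ''p'' = N ''p''" "N' ''o'' = N ''o''" "N' ''u'' = N ''u''"
    using o by (auto simp: s' agree_off_def)
  show "runs H (Seq (NAssign ''p'' [nvar ''l''] (NAdd (NVar ''p'' [nvar ''l'']) (NConst 1)))
         (Seq (NAssign ''f'' [] (NVar ''o'' [nvar ''l'']))
           (Seq (NAssign ''o'' [nvar ''l''] (NAdd (nvar ''u'') (NConst 1)))
             (NAssign ''u'' [] (NSub (nvar ''f'') (NConst 1)))))) s' (\<lambda>s'. \<exists>l<n.
    (\<forall>k<n. N ''w'' [N ''u'' [], k] + N ''p'' [l] \<le> N ''w'' [N ''u'' [], l] + N ''p'' [k]) \<and>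
    fst s' ''p'' = (N ''p'')([l] := Suc (N ''p'' [l])) \<and>
    fst s' ''o'' = (N ''o'')([l] := Suc (N ''u'' [])) \<and>
    fst s' ''f'' [] = N ''o'' [l] \<and> fst s' ''u'' [] = N ''o'' [l] - 1)"
    by (rule runs_straight_line, simp, rule exI[of _ "N' ''l'' []"]) (use l in \<open>simp add: s' eq\<close>)
qed

text \<open>Phase \<open>i\<close> brings in agent \<open>i\<close> and follows the chain of
  displaced agents until a free bundle is taken. Setting \<open>f\<close> to 1 merely makes the
  inner loop start.\<close>

definition auction :: com where
  "auction =
     Seq (For ''i'' ''n'' (Seq (NAssign ''p'' [nvar ''i''] (NConst 0)) (NAssign ''o'' [nvar ''i''] (NConst 0))))
       (For ''i'' ''n''
         (Seq (NAssign ''u'' [] (nvar ''i''))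
           (Seq (NAssign ''f'' [] (NConst 1))
             (While (nonzero (nvar ''f'')) auction_round))))"

lemma auction_writes [simp]:
  "nat_writes auction = {''i'', ''k'', ''l'', ''p'', ''f'', ''o'', ''u''}" "real_writes auction = {}"
  by (auto simp: auction_def)

lemma runs_auction_phase:
  assumes n: "N ''n'' [] = n" "n \<le> H" and i: "i < n"
    and C: "\<forall>i<n. \<forall>j<n. N ''w'' [i, j] \<le> C" "n * (C + 1) \<le> H"
    and inv: "auction_inv n (\<lambda>i j. N ''w'' [i, j]) {..<i} (\<lambda>j. N ''p'' [j]) (\<lambda>j. N ''o'' [j])"
    and u: "N ''u'' [] = i" "N ''f'' [] = 1"
  shows "runs H (While (nonzero (nvar ''f'')) auction_round) (N, R)
    (\<lambda>s'. auction_inv n (\<lambda>i j. N ''w'' [i, j]) {..<Suc i} (\<lambda>j. fst s' ''p'' [j]) (\<lambda>j. fst s' ''o'' [j]))"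
proof -
  let ?w = "\<lambda>i j. N ''w'' [i, j]"
  let ?inv = "\<lambda>S s. auction_inv n ?w S (\<lambda>j. fst s ''p'' [j]) (\<lambda>j. fst s ''o'' [j])"
  \<comment> \<open>During the phase the current bidder is the only one of the agents up to
    \<open>i\<close> that owns no bundle.\<close>
  let ?I = "\<lambda>s. \<exists>S. ?inv S s \<and> S \<subseteq> {..<n} \<and> (if fst s ''f'' [] = 0 then S = {..<Suc i}
      else fst s ''u'' [] < n \<and> fst s ''u'' [] \<notin> S \<and> insert (fst s ''u'' []) S = {..<Suc i})"
  \<comment> \<open>Every bid increases this sum by 1 and \<open>auction_price_bound\<close> limits
    it, so its distance to the limit is the variant.\<close>
  let ?P = "\<lambda>s. (\<Sum>j<n. fst s ''p'' [j])"
  show ?thesis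
  proof (rule runs_While[where I = ?I and f = "\<lambda>s. n * (C + 1) - ?P s"])
    show "?I (N, R)" using inv i u by (intro exI[of _ "{..<i}"]) auto
    show "n * (C + 1) - ?P (N, R) \<le> H" using C(2) by simp
  next
    fix s assume I: "?I s" and f: "bval s (nonzero (nvar ''f''))"
      and off: "agree_off (nat_writes auction_round) (real_writes auction_round) (N, R) s"
    obtain N' R' where s: "s = (N', R')" by (cases s)
    have eq: "N' ''n'' [] = n" "N' ''w'' = N ''w''" using off n by (auto simp: s agree_off_def)
    define u where "u = N' ''u'' []"
    obtain S where S: "?inv S s" "S \<subseteq> {..<n}" "u < n" "u \<notin> S" "insert u S = {..<Suc i}"
      using I f by (auto simp: s u_def)
    show "runs H auction_round s (\<lambda>s'. ?I s' \<and> n * (C + 1) - ?P s' < n * (C + 1) - ?P s)"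
      unfolding s
    proof (rule runs_weaken[OF runs_auction_round[where N = N' and R = R', OF eq(1) n(2)]])
      show "0 < n" using i by simp
    next
      fix s' assume "\<exists>l<n.
        (\<forall>k<n. N' ''w'' [N' ''u'' [], k] + N' ''p'' [l] \<le> N' ''w'' [N' ''u'' [], l] + N' ''p'' [k]) \<and>
        fst s' ''p'' = (N' ''p'')([l] := Suc (N' ''p'' [l])) \<and>
        fst s' ''o'' = (N' ''o'')([l] := Suc (N' ''u'' [])) \<and>
        fst s' ''f'' [] = N' ''o'' [l] \<and> fst s' ''u'' [] = N' ''o'' [l] - 1"
      then obtain l where l: "l < n" "\<forall>k<n. ?w u k + N' ''p'' [l] \<le> ?w u l + N' ''p'' [k]"
        and s': "fst s' ''p'' = (N' ''p'')([l] := Suc (N' ''p'' [l]))" "fst s' ''o'' = (N' ''o'')([l] := Suc u)"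
          "fst s' ''f'' [] = N' ''o'' [l]" "fst s' ''u'' [] = N' ''o'' [l] - 1"
        unfolding u_def eq(2) by blast
      define S' where "S' = insert u (if N' ''o'' [l] = 0 then S else S - {N' ''o'' [l] - 1})"
      have inv': "?inv S' s'"
        using auction_bid[OF S(1)[unfolded s fst_conv] S(2-4) l]
        unfolding S'_def by (rule auction_inv_cong) (auto simp: s')
      have S'n: "S' \<subseteq> {..<n}" using S by (auto simp: S'_def)
      have "N' ''o'' [l] - 1 \<in> S" if "N' ''o'' [l] \<noteq> 0"
      proof -
        have "N' ''o'' [l] \<in> Suc ` S" using S(1) l(1) that by (auto simp: s auction_inv_def)
        then show ?thesis by auto
      qed
      then have "?I s'" using inv' S'n S by (intro exI[of _ S']) (auto simp: s' S'_def)
      moreover have "?P s' = Suc (?P s)"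
      proof -
        have "(\<Sum>j\<in>{..<n} - {l}. fst s' ''p'' [j]) = (\<Sum>j\<in>{..<n} - {l}. fst s ''p'' [j])"
          by (rule sum.cong) (auto simp: s s')
        then show ?thesis using l(1) by (simp add: sum.remove[of "{..<n}" l]) (simp add: s s')
      qed
      moreover have "?P s' \<le> n * (C + 1)" by (rule auction_price_bound[OF inv' S'n C(1)])
      ultimately show "?I s' \<and> n * (C + 1) - ?P s' < n * (C + 1) - ?P (N', R')"
        by (simp add: s)
    qed
  qed (auto split: if_splits)
qed

lemma runs_auction:
  assumes n: "N ''n'' [] = n" "n \<le> H"
    and C: "\<forall>i<n. \<forall>j<n. N ''w'' [i, j] \<le> C" "n * (C + 1) \<le> H"
  shows "runs H auction (N, R)
    (\<lambda>s'. auction_inv n (\<lambda>i j. N ''w'' [i, j]) {..<n} (\<lambda>j. fst s' ''p'' [j]) (\<lambda>j. fst s' ''o'' [j]))"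
  unfolding auction_def
proof (rule runs_Seq)
  show "runs H (For ''i'' ''n'' (Seq (NAssign ''p'' [nvar ''i''] (NConst 0)) (NAssign ''o'' [nvar ''i''] (NConst 0))))
      (N, R) (\<lambda>s'. \<forall>j<n. fst s' ''p'' [j] = 0 \<and> fst s' ''o'' [j] = 0)"
    by (rule runs_For[where h = n and I = "\<lambda>i N R. \<forall>j<i. N ''p'' [j] = 0 \<and> N ''o'' [j] = 0"])
      (use n in \<open>auto intro!: runs_straight_line\<close>)
next
  fix s' assume z: "\<forall>j<n. fst s' ''p'' [j] = 0 \<and> fst s' ''o'' [j] = 0"
    and off: "agree_off (nat_writes (For ''i'' ''n'' (Seq (NAssign ''p'' [nvar ''i''] (NConst 0)) (NAssign ''o'' [nvar ''i''] (NConst 0)))))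
      (real_writes (For ''i'' ''n'' (Seq (NAssign ''p'' [nvar ''i''] (NConst 0)) (NAssign ''o'' [nvar ''i''] (NConst 0))))) (N, R) s'"
  obtain N' R' where s': "s' = (N', R')" by (cases s')
  have eq: "N' ''n'' [] = n" "N' ''w'' = N ''w''" using off n by (auto simp: s' agree_off_def)
  let ?w = "\<lambda>i j. N ''w'' [i, j]"
  show "runs H (For ''i'' ''n'' (Seq (NAssign ''u'' [] (nvar ''i''))
           (Seq (NAssign ''f'' [] (NConst 1)) (While (nonzero (nvar ''f'')) auction_round)))) s'
      (\<lambda>s'. auction_inv n ?w {..<n} (\<lambda>j. fst s' ''p'' [j]) (\<lambda>j. fst s' ''o'' [j]))"
  proof (rule runs_For[where h = n
        and I = "\<lambda>i N R. auction_inv n ?w {..<i} (\<lambda>j. N ''p'' [j]) (\<lambda>j. N ''o'' [j])"], goal_cases)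
    case 7
    show ?case using auction_inv_cong[OF auction_inv_init] z by simp
  next
    case (8 i N1 R1)
    then have eq1: "N1 ''n'' [] = n" "N1 ''w'' = N ''w''" using eq by (auto simp: s' agree_off_def)
    show ?case
      by ((rule runs_Seq_straight_line, simp)+, unfold result.simps nupdate_pair list.map nval.simps,
          rule runs_weaken[OF runs_auction_phase[where i = i and C = C]])
        (use 8 C n eq1 in auto)
  qed (use eq n in \<open>auto simp: s'\<close>)
qed

text \<open>The auction assigns every agent a bundle, so an agent is unmatched exactly if its pair
  has weight 0. As in \<open>o\<close>, agents are stored as successors, and \<open>e = 0\<close>
  means that none was found.\<close>

definition find_unmatched :: com where
  "find_unmatched =
     Seq (NAssign ''e'' [] (NConst 0))
       (For ''j'' ''n''
         (Cond (nonzero (NVar ''w'' [NSub (NVar ''o'' [nvar ''j'']) (NConst 1), nvar ''j'']))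
           Skip
           (NAssign ''e'' [] (NVar ''o'' [nvar ''j'']))))"

lemma find_unmatched_writes [simp]:
  "nat_writes find_unmatched = {''e'', ''j''}" "real_writes find_unmatched = {}"
  by (auto simp: find_unmatched_def)

lemma runs_find_unmatched:
  assumes n: "N ''n'' [] = n" "n \<le> H" and nz: "\<forall>j<n. N ''o'' [j] \<noteq> 0"
  shows "runs H find_unmatched (N, R) (\<lambda>s'.
    if fst s' ''e'' [] = 0 then \<forall>j<n. N ''w'' [N ''o'' [j] - 1, j] \<noteq> 0
    else \<exists>j<n. N ''w'' [N ''o'' [j] - 1, j] = 0 \<and> fst s' ''e'' [] = N ''o'' [j])"
proof -
  define u where "u j = N ''w'' [N ''o'' [j] - 1, j]" for j
  define F where "F h e \<longleftrightarrow> (if e = 0 then \<forall>j<h. u j \<noteq> 0 else \<exists>j<n. u j = 0 \<and> e = N ''o'' [j])" for h e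
  have F_old: "F (Suc j) e" if "F j e" "u j \<noteq> 0" for j e
    using that by (auto simp: F_def less_Suc_eq)
  have F_new: "F (Suc j) (N ''o'' [j])" if "u j = 0" "j < n" for j
    using that nz by (auto simp: F_def)
  show ?thesis
    unfolding find_unmatched_def u_def[symmetric] F_def[symmetric]
  proof (intro runs_Seq_straight_line runs_For[where h = n and I = "\<lambda>h N' R'. F h (N' ''e'' [])"], goal_cases)
    case (9 j N' R')
    then have eq: "N' ''o'' = N ''o''" "N' ''w'' = N ''w''" "N' ''j'' [] = j" by (auto simp: agree_off_def)
    show ?case
    proof (rule runs_Cond)
      assume "bval (N', R') (nonzero (NVar ''w'' [NSub (NVar ''o'' [nvar ''j'']) (NConst 1), nvar ''j'']))"
      then have "u j \<noteq> 0" by (simp add: eq u_def)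
      then show "runs H Skip (N', R') (\<lambda>s'. F (Suc j) (fst s' ''e'' []))"
        using F_old 9 by (intro runs_straight_line) simp_all
    next
      assume "\<not> bval (N', R') (nonzero (NVar ''w'' [NSub (NVar ''o'' [nvar ''j'']) (NConst 1), nvar ''j'']))"
      then have "u j = 0" by (simp add: eq u_def)
      then show "runs H (NAssign ''e'' [] (NVar ''o'' [nvar ''j''])) (N', R') (\<lambda>s'. F (Suc j) (fst s' ''e'' []))"
        using F_new 9 by (intro runs_straight_line) (simp_all add: eq)
    qed
  qed (use n in \<open>auto simp: F_def\<close>)
qed

text \<open>The value \<open>m\<close> of \<open>z\<close>, which is not the position of an item,
  means that no candidate has been found yet.\<close>

definition remove_item :: com where
  "remove_item =
     Seq (Seq (NAssign ''e'' [] (NSub (nvar ''e'') (NConst 1)))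
         (Seq (NAssign ''j'' [] (NVar ''d'' [nvar ''e''])) (NAssign ''z'' [] (nvar ''m''))))
       (Seq
         (For ''g'' ''m''
           (Cond (BAnd (nonzero (nmat ''x'' ''j'' ''g''))
                   (BNot (BAnd (NLess (nvar ''z'') (nvar ''m''))
                     (BNot (RLess (rmat ''v'' ''e'' ''g'') (rmat ''v'' ''e'' ''z''))))))
             (NAssign ''z'' [] (nvar ''g''))
             Skip))
         (Seq (NAssign ''x'' [nvar ''j'', nvar ''z''] (NConst 0)) (NAssign ''t'' [nvar ''j''] (NConst 1))))"

lemma remove_item_writes [simp]:
  "nat_writes remove_item = {''e'', ''j'', ''z'', ''g'', ''x'', ''t''}" "real_writes remove_item = {}"
  by (auto simp: remove_item_def)

lemma runs_remove_item:
  assumes m: "N ''m'' [] = m" "m \<le> H" and e: "N ''e'' [] = Suc e" and j: "N ''d'' [e] = j"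
    and ne: "\<exists>g<m. N ''x'' [j, g] \<noteq> 0"
  shows "runs H remove_item (N, R) (\<lambda>s'. \<exists>z<m. N ''x'' [j, z] \<noteq> 0 \<and>
    (\<forall>g<m. N ''x'' [j, g] \<noteq> 0 \<longrightarrow> R ''v'' [e, z] \<le> R ''v'' [e, g]) \<and>
    fst s' ''x'' = (N ''x'')([j, z] := 0) \<and> fst s' ''t'' = (N ''t'')([j] := 1))"
  unfolding remove_item_def
proof (rule runs_Seq_straight_line, goal_cases)
  case 2
  define P where "P g \<longleftrightarrow> N ''x'' [j, g] \<noteq> 0" for g
  define f where "f g = R ''v'' [e, g]" for g
  define J where "J h z \<longleftrightarrow> (if z < m then P z \<and> (\<forall>g<h. P g \<longrightarrow> f z \<le> f g) else \<forall>g<h. \<not> P g)"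
    for h z
  have J_new: "J (Suc g) g" if "J g z" "P g" "z < m \<longrightarrow> f g < f z" "g < m" for g z
  proof -
    have "f g \<le> f g'" if "g' < g" "P g'" for g'
      using that \<open>J g z\<close> \<open>z < m \<longrightarrow> f g < f z\<close> by (cases "z < m") (force simp: J_def)+
    then show ?thesis using that by (auto simp: J_def less_Suc_eq)
  qed
  have J_old: "J (Suc g) z" if "J g z" "P g \<longrightarrow> z < m \<and> f z \<le> f g" for g z
    using that by (auto simp: J_def less_Suc_eq)
  obtain N1 where N1: "result (Seq (NAssign ''e'' [] (NSub (nvar ''e'') (NConst 1)))
      (Seq (NAssign ''j'' [] (NVar ''d'' [nvar ''e''])) (NAssign ''z'' [] (nvar ''m'')))) (N, R) = (N1, R)"
    and eq1: "N1 ''e'' [] = e" "N1 ''j'' [] = j" "N1 ''z'' [] = m" "N1 ''m'' [] = m"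
      "N1 ''x'' = N ''x''" "N1 ''t'' = N ''t''"
    using e j m by simp
  show ?case unfolding N1
  proof (rule runs_Seq[OF runs_For[where h = m and I = "\<lambda>h N' R'. J h (N' ''z'' [])"
          and Q = "\<lambda>s'. J m (fst s' ''z'' [])"]], goal_cases)
    case (8 g N' R')
    then have eq: "N' ''e'' [] = e" "N' ''j'' [] = j" "N' ''m'' [] = m" "N' ''x'' = N ''x''" "R' = R"
      using eq1 by (auto simp: agree_off_def)
    show ?case
    proof (rule runs_straight_line, simp, cases "P g \<and> (N' ''z'' [] < m \<longrightarrow> f g < f (N' ''z'' []))")
      case True
      then show "J (Suc g) (fst (result (Cond (BAnd (nonzero (nmat ''x'' ''j'' ''g''))
                   (BNot (BAnd (NLess (nvar ''z'') (nvar ''m''))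
                     (BNot (RLess (rmat ''v'' ''e'' ''g'') (rmat ''v'' ''e'' ''z''))))))
             (NAssign ''z'' [] (nvar ''g''))
             Skip) (N', R')) ''z'' [])"
        using J_new[of g "N' ''z'' []"] 8 by (simp add: eq P_def f_def)
    next
      case False
      then show "J (Suc g) (fst (result (Cond (BAnd (nonzero (nmat ''x'' ''j'' ''g''))
                   (BNot (BAnd (NLess (nvar ''z'') (nvar ''m''))
                     (BNot (RLess (rmat ''v'' ''e'' ''g'') (rmat ''v'' ''e'' ''z''))))))
             (NAssign ''z'' [] (nvar ''g''))
             Skip) (N', R')) ''z'' [])"
        using J_old[of g "N' ''z'' []"] 8 by (auto simp: eq P_def f_def not_less)
    qed
  next
    case (10 s')
    obtain N' R' where s': "s' = (N', R')" by (cases s')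
    have eq: "N' ''x'' = N ''x''" "N' ''t'' = N ''t''" "N' ''j'' [] = j"
      using 10(2) eq1 by (auto simp: s' agree_off_def)
    have J: "J m (N' ''z'' [])" using 10(1) by (simp add: s')
    then have z: "N' ''z'' [] < m" using ne by (auto simp: J_def P_def split: if_splits)
    then have "P (N' ''z'' []) \<and> (\<forall>g<m. P g \<longrightarrow> f (N' ''z'' []) \<le> f g)" using J by (simp add: J_def)
    then show ?case
      by (intro runs_straight_line exI[of _ "N' ''z'' []"]) (use z in \<open>simp_all add: s' eq P_def f_def\<close>)
  qed (use eq1 m in \<open>simp_all add: J_def\<close>)
qed simp

text \<open>The square and the cube of \<open>n + 1\<close> are built by repeated addition, since
  the machine has no multiplication.\<close>

definition weight_constants :: com where
  "weight_constants =
     Seq (Seq (NAssign ''a'' [] (NAdd (nvar ''n'') (NConst 1))) (NAssign ''b'' [] (NConst 0)))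
       (Seq (For ''i'' ''a'' (NAssign ''b'' [] (NAdd (nvar ''b'') (nvar ''a''))))
         (Seq (NAssign ''c'' [] (NConst 0))
           (For ''i'' ''a'' (NAssign ''c'' [] (NAdd (nvar ''c'') (nvar ''b''))))))"

lemma weight_constants_writes [simp]:
  "nat_writes weight_constants = {''a'', ''b'', ''c'', ''i''}" "real_writes weight_constants = {}"
  by (auto simp: weight_constants_def)

lemma runs_weight_constants:
  assumes n: "N ''n'' [] = n" "Suc n \<le> H"
  shows "runs H weight_constants (N, R) (\<lambda>s'. fst s' ''a'' [] = Suc n \<and>
    fst s' ''b'' [] = Suc n * Suc n \<and> fst s' ''c'' [] = Suc n * (Suc n * Suc n))"
  unfolding weight_constants_def
proof (rule runs_Seq_straight_line, goal_cases)
  case 2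
  let ?c = "NAssign ''c'' [] (NAdd (nvar ''c'') (nvar ''b''))"
  show ?case
  proof (rule runs_Seq[OF runs_For[where h = "Suc n" and I = "\<lambda>k N R. N ''b'' [] = k * Suc n"
        and Q = "\<lambda>s'. fst s' ''b'' [] = Suc n * Suc n \<and> fst s' ''a'' [] = Suc n"]], goal_cases)
    case (8 k N' R')
    then show ?case by (intro runs_straight_line) (auto simp: n agree_off_def)
  next
    case (10 s')
    obtain N' R' where s': "s' = (N', R')" by (cases s')
    show ?case
    proof (rule runs_Seq_straight_line, simp, rule runs_For[where h = "Suc n"
          and I = "\<lambda>k N R. N ''c'' [] = k * (Suc n * Suc n)"], goal_cases)
      case (8 k N1 R1)
      then show ?case using 10 by (intro runs_straight_line) (auto simp: s' agree_off_def)
    qed (use 10 n in \<open>auto simp: s' agree_off_def\<close>)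
  qed (use n in \<open>auto simp: agree_off_def\<close>)
qed simp

definition copy_output :: com where
  "copy_output =
     For ''i'' ''n'' (For ''g'' ''m'' (NAssign ''y'' [nvar ''i'', nvar ''g''] (nmat ''x'' ''i'' ''g'')))"

lemma copy_output_writes [simp]:
  "nat_writes copy_output = {''i'', ''g'', ''y''}" "real_writes copy_output = {}"
  by (auto simp: copy_output_def)

lemma runs_copy_output:
  assumes n: "N ''n'' [] = n" "n \<le> H" and m: "N ''m'' [] = m" "m \<le> H"
  shows "runs H copy_output (N, R) (\<lambda>s'. \<forall>i<n. \<forall>g<m. fst s' ''y'' [i, g] = N ''x'' [i, g])"
  unfolding copy_output_def
proof (rule runs_For2[where h = n and l = m and P = "\<lambda>i g N' R'. N' ''y'' [i, g] = N ''x'' [i, g]"], goal_cases)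
  case (16 i g N' R')
  then show ?case by (intro runs_straight_line) (auto simp: agree_off_def)
qed (use n m in auto)

section \<open>The program\<close>

lemma sum_items:
  assumes "distinct gs" and "B \<subseteq> set gs"
  shows "(\<Sum>g<length gs. if gs ! g \<in> B then v i (gs ! g) else 0) = val v i B"
proof -
  have "bij_betw ((!) gs) {..<length gs} (set gs)"
    using assms(1) by (intro bij_betw_nth) auto
  then have "(\<Sum>g<length gs. if gs ! g \<in> B then v i (gs ! g) else 0) = (\<Sum>x\<in>set gs. if x \<in> B then v i x else 0)"
    by (rule sum.reindex_bij_betw)
  also have "\<dots> = (\<Sum>x\<in>set gs \<inter> B. v i x)" by (simp add: sum.inter_restrict)
  also have "set gs \<inter> B = B" using assms(2) by blast
  finally show ?thesis by (simp add: val_def)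
qed

lemma partial_max_eq_Max: "partial_max P f m = Max (insert 0 (f ` {g. g < m \<and> P g}))"
proof (induction m)
  case (Suc m)
  let ?S = "insert 0 (f ` {g. g < m \<and> P g})"
  have "finite ?S" by simp
  then have max: "Max (insert (f m) ?S) = max (f m) (Max ?S)" by (rule Max_insert) simp
  have "{g. g < Suc m \<and> P g} = (if P m then insert m {g. g < m \<and> P g} else {g. g < m \<and> P g})"
    by (auto simp: less_Suc_eq)
  then have "insert 0 (f ` {g. g < Suc m \<and> P g}) =
      (if P m then insert (f m) (insert 0 (f ` {g. g < m \<and> P g})) else insert 0 (f ` {g. g < m \<and> P g}))"
    by auto
  then have "Max (insert 0 (f ` {g. g < Suc m \<and> P g})) = (if P m then max (f m) (Max ?S) else Max ?S)"
    using max by (cases "P m") (simp_all only: if_True if_False)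
  also have "\<dots> = partial_max P f (Suc m)" unfolding Suc[symmetric] by (simp add: max_def not_le)
  finally show ?case by (rule sym)
qed simp

lemma partial_max_cong:
  assumes "\<And>g. g < m \<Longrightarrow> P g = P' g" and "\<And>g. g < m \<Longrightarrow> f g = f' g"
  shows "partial_max P f m = partial_max P' f' m"
  using assms by (induction m) auto

text \<open>Inserting 0 covers the empty bundle; for other bundles it changes nothing, as all
  candidates are nonnegative.\<close>

lemma max_minus_one_eq_Max:
  assumes "finite B" and "\<forall>g\<in>B. 0 \<le> v i g"
  shows "max_minus_one v i B = Max (insert 0 ((\<lambda>g. val v i B - v i g) ` B))"
proof (cases "B = {}")
  case False
  have "(\<lambda>g. val v i B - v i g) ` B = (\<lambda>g. val v i (B - {g})) ` B"
    using assms(1) by (intro image_cong) (auto simp: val_def sum_diff1)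
  then have "Max (insert 0 ((\<lambda>g. val v i B - v i g) ` B)) = max 0 (max_minus_one v i B)"
    using False assms(1) by (simp add: max_minus_one_def)
  then show ?thesis using max_minus_one_nonneg[of B v i] assms by simp
qed (simp add: max_minus_one_def)

lemma partial_max_items:
  assumes "B \<subseteq> set gs" and "\<forall>g\<in>B. 0 \<le> v i g"
  shows "partial_max (\<lambda>g. gs ! g \<in> B) (\<lambda>g. val v i B - v i (gs ! g)) (length gs) = max_minus_one v i B"
proof -
  have "(\<lambda>g. val v i B - v i (gs ! g)) ` {g. g < length gs \<and> gs ! g \<in> B} = (\<lambda>g. val v i B - v i g) ` B"
  proof (intro equalityI subsetI)
    fix y assume "y \<in> (\<lambda>g. val v i B - v i g) ` B"
    then obtain x where x: "x \<in> B" "y = val v i B - v i x" by blast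
    then obtain g where "g < length gs" "gs ! g = x" using assms(1) by (meson in_set_conv_nth subsetD)
    then show "y \<in> (\<lambda>g. val v i B - v i (gs ! g)) ` {g. g < length gs \<and> gs ! g \<in> B}"
      using x by blast
  qed auto
  then show ?thesis
    using max_minus_one_eq_Max[of B v i] finite_subset[OF assms(1)] assms(2)
    by (simp add: partial_max_eq_Max)
qed

text \<open>The flags \<open>t\<close> are needed because \<open>x\<close> is overwritten: the
  original \<open>X\<close> is no longer in memory, so touched bundles cannot be recognized by
  comparison. Only whether an entry of \<open>x\<close> or \<open>t\<close> is nonzero
  matters.\<close>

definition encodes ::
  "nat \<Rightarrow> (nat \<Rightarrow> 'a \<Rightarrow> real) \<Rightarrow> (nat \<Rightarrow> 'a set) \<Rightarrow> 'a list \<Rightarrow> (nat \<Rightarrow> 'a set) \<Rightarrow> state \<Rightarrow> bool" where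
  "encodes n v X gs Z s \<longleftrightarrow>
     fst s ''n'' [] = n \<and> fst s ''m'' [] = length gs \<and>
     (\<forall>i<n. \<forall>g<length gs. snd s ''v'' [i, g] = v i (gs ! g)) \<and>
     (\<forall>j<n. \<forall>g<length gs. fst s ''x'' [j, g] \<noteq> 0 \<longleftrightarrow> gs ! g \<in> Z j) \<and>
     (\<forall>j<n. fst s ''t'' [j] \<noteq> 0 \<longleftrightarrow> j \<in> touched n X Z)"

lemma encodes_agree_off:
  assumes "encodes n v X gs Z s" and "agree_off A B s s'"
    and "''n'' \<notin> A" "''m'' \<notin> A" "''x'' \<notin> A" "''t'' \<notin> A" "''v'' \<notin> B"
  shows "encodes n v X gs Z s'"
  using assms unfolding encodes_def agree_off_def by simp

lemma encodes_input:
  "encodes n v X gs X (input_state n v X gs)"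
  by (auto simp: encodes_def input_state_def touched_def)

definition compute_weights :: com where
  "compute_weights = Seq bundle_values (Seq robust_values (Seq robust_demands edge_weights))"

lemma compute_weights_writes [simp]:
  "nat_writes compute_weights = {''i'', ''k'', ''g'', ''d'', ''w''}"
  "real_writes compute_weights = {''s'', ''q''}"
  by (auto simp: compute_weights_def)

definition remove_if_unmatched :: com where
  "remove_if_unmatched = Seq find_unmatched (Cond (nonzero (nvar ''e'')) remove_item Skip)"

definition algorithm_round :: com where
  "algorithm_round = Seq compute_weights (Seq auction remove_if_unmatched)"

lemma remove_if_unmatched_writes [simp]:
  "nat_writes remove_if_unmatched = {''e'', ''j'', ''z'', ''g'', ''x'', ''t''}"
  "real_writes remove_if_unmatched = {}"
  by (auto simp: remove_if_unmatched_def)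

lemma algorithm_round_writes [simp]:
  "nat_writes algorithm_round =
     {''i'', ''k'', ''g'', ''d'', ''w'', ''l'', ''p'', ''f'', ''o'', ''u'', ''e'', ''j'', ''z'', ''x'', ''t''}"
  "real_writes algorithm_round = {''s'', ''q''}"
  by (auto simp: algorithm_round_def)

text \<open>A fixed number of \<open>m + 1\<close> rounds replaces a stopping test. Rounds after the
  algorithm has finished recompute the matching but leave the family unchanged.\<close>

definition main_program :: com where
  "main_program =
     Seq weight_constants
       (Seq (NAssign ''h'' [] (NAdd (nvar ''m'') (NConst 1)))
         (Seq (For ''r'' ''h'' algorithm_round) copy_output))"

abbreviation max_weight :: "nat \<Rightarrow> nat" where
  "max_weight K \<equiv> K + K * K + K * (K * K)"

lemma edge_weight_le: "edge_weight K T G e \<le> max_weight K"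
  by (simp add: edge_weight_def)

text \<open>The three bounds on \<open>H\<close> serve the construction of the weight constants, the
  rounds of the main loop, and the bids of the auction.\<close>

locale encoded_nw_optimal = nw_optimal n \<M> v X
  for n :: nat and \<M> :: "'a set" and v X +
  fixes gs :: "'a list" and H :: nat
  assumes gs: "distinct gs" "set gs = \<M>"
    and H: "Suc n \<le> H" "Suc (length gs) \<le> H" "n * (max_weight (Suc n) + 1) \<le> H"
begin

definition constants :: "nstore \<Rightarrow> bool" where
  "constants N \<longleftrightarrow> N ''a'' [] = Suc n \<and> N ''b'' [] = Suc n * Suc n \<and> N ''c'' [] = Suc n * (Suc n * Suc n)"

lemma runs_compute_weights:
  assumes enc: "encodes n v X gs Z s" and safe: "safe Z" and con: "constants (fst s)"
  shows "runs H compute_weights s (\<lambda>s'. (\<forall>i<n. robust_demand n v Z i (fst s' ''d'' [i])) \<and>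
    (\<forall>i<n. \<forall>k<n. fst s' ''w'' [i, k] =
       edge_weight (Suc n) (touched n X Z) (feasibility_graph n v Z) (i, k)))"
    (is "runs H _ s ?Q")
proof -
  obtain N R where s: "s = (N, R)" by (cases s)
  have sub: "Z k \<subseteq> \<M>" if "k < n" for k using safe_subset_items[OF safe that] .
  have N: "N ''n'' [] = n" "N ''m'' [] = length gs"
    and v: "\<And>i g. i < n \<Longrightarrow> g < length gs \<Longrightarrow> R ''v'' [i, g] = v i (gs ! g)"
    and x: "\<And>j g. j < n \<Longrightarrow> g < length gs \<Longrightarrow> N ''x'' [j, g] \<noteq> 0 \<longleftrightarrow> gs ! g \<in> Z j"
    and t: "\<And>j. j < n \<Longrightarrow> N ''t'' [j] \<noteq> 0 \<longleftrightarrow> j \<in> touched n X Z"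
    using enc by (auto simp: encodes_def s)
  have c: "N ''a'' [] = Suc n" "N ''b'' [] = Suc n * Suc n" "N ''c'' [] = Suc n * (Suc n * Suc n)"
    using con by (auto simp: constants_def s)
  have nH: "n \<le> H" "length gs \<le> H" using H by auto
  show ?thesis
    unfolding compute_weights_def s
  proof (rule runs_Seq[OF runs_bundle_values[where N = N and R = R, OF N(1) nH(1) N(2) nH(2)]])
    fix s1 assume q1: "\<forall>i<n. \<forall>k<n. snd s1 ''s'' [i, k] =
        (\<Sum>g<length gs. if N ''x'' [k, g] = 0 then 0 else R ''v'' [i, g])"
      and o1: "agree_off (nat_writes bundle_values) (real_writes bundle_values) (N, R) s1"
    obtain N1 R1 where s1: "s1 = (N1, R1)" by (cases s1)
    have e1: "N1 ''n'' = N ''n''" "N1 ''m'' = N ''m''" "N1 ''x'' = N ''x''" "N1 ''t'' = N ''t''"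
      "N1 ''a'' = N ''a''" "N1 ''b'' = N ''b''" "N1 ''c'' = N ''c''" "R1 ''v'' = R ''v''"
      using o1 by (auto simp: s1 agree_off_def)
    have val: "R1 ''s'' [i, k] = val v i (Z k)" if "i < n" "k < n" for i k
    proof -
      have "R1 ''s'' [i, k] = (\<Sum>g<length gs. if gs ! g \<in> Z k then v i (gs ! g) else 0)"
        unfolding q1[rule_format, OF that, unfolded s1 snd_conv]
        using that v x[OF that(2)] by (intro sum.cong) force+
      then show ?thesis using sum_items[OF gs(1)] sub[OF that(2)] gs(2) by simp
    qed
    show "runs H (Seq robust_values (Seq robust_demands edge_weights)) s1 ?Q"
      unfolding s1
    proof (rule runs_Seq[OF runs_robust_values[where N = N1 and R = R1 and n = n and m = "length gs"]])
      fix s2 assume q2: "\<forall>i<n. \<forall>k<n. snd s2 ''q'' [i, k] =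
          partial_max (\<lambda>g. N1 ''x'' [k, g] \<noteq> 0) (\<lambda>g. R1 ''s'' [i, k] - R1 ''v'' [i, g]) (length gs)"
        and o2: "agree_off (nat_writes robust_values) (real_writes robust_values) (N1, R1) s2"
      obtain N2 R2 where s2: "s2 = (N2, R2)" by (cases s2)
      have e2: "N2 ''n'' = N ''n''" "N2 ''t'' = N ''t''" "R2 ''s'' = R1 ''s''"
        "N2 ''a'' = N ''a''" "N2 ''b'' = N ''b''" "N2 ''c'' = N ''c''"
        using o2 by (auto simp: s2 agree_off_def e1)
      have mmo: "R2 ''q'' [i, k] = max_minus_one v i (Z k)" if "i < n" "k < n" for i k
      proof -
        have "R2 ''q'' [i, k] =
            partial_max (\<lambda>g. gs ! g \<in> Z k) (\<lambda>g. val v i (Z k) - v i (gs ! g)) (length gs)"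
          using q2 that v x val by (simp add: s2 e1 cong: partial_max_cong)
        then show ?thesis
          using partial_max_items[of "Z k" gs v i] v_nonneg[OF that(1) sub[OF that(2)]] sub[OF that(2)] gs(2)
          by simp
      qed
      show "runs H (Seq robust_demands edge_weights) s2 ?Q"
        unfolding s2
      proof (rule runs_Seq[OF runs_robust_demands[where N = N2 and R = R2 and n = n]])
        fix s3 assume q3: "\<forall>i<n. fst s3 ''d'' [i] < n \<and>
            (\<forall>k<n. R2 ''q'' [i, k] \<le> R2 ''q'' [i, fst s3 ''d'' [i]])"
          and o3: "agree_off (nat_writes robust_demands) (real_writes robust_demands) (N2, R2) s3"
        obtain N3 R3 where s3: "s3 = (N3, R3)" by (cases s3)
        have e3: "N3 ''n'' = N ''n''" "N3 ''t'' = N ''t''" "R3 ''s'' = R1 ''s''" "R3 ''q'' = R2 ''q''"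
          "N3 ''a'' = N ''a''" "N3 ''b'' = N ''b''" "N3 ''c'' = N ''c''"
          using o3 by (auto simp: s3 agree_off_def e2)
        have dem: "robust_demand n v Z i (N3 ''d'' [i])" if "i < n" for i
          using q3 that mmo[OF that] by (auto simp: robust_demand_def s3)
        have feas: "efx_feasible n v Z i k \<longleftrightarrow> R3 ''q'' [i, N3 ''d'' [i]] \<le> R3 ''s'' [i, k]"
          if "i < n" "k < n" for i k
          using dem[OF that(1)] that
          by (auto simp: e3 robust_demand_def efx_feasible_def mmo val intro: order_trans)
        show "runs H edge_weights s3 ?Q"
          unfolding s3
        proof (rule runs_weaken[OF runs_edge_weights[where N = N3 and R = R3 and n = n]])
          fix s4 assume q4: "\<forall>i<n. \<forall>k<n. fst s4 ''w'' [i, k] =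
    (if R3 ''q'' [i, N3 ''d'' [i]] \<le> R3 ''s'' [i, k] \<and> (i \<noteq> k \<longrightarrow> R3 ''s'' [i, i] < R3 ''s'' [i, k])
     then N3 ''a'' [] + (if i = k then N3 ''b'' [] else 0) + (if N3 ''t'' [k] \<noteq> 0 then N3 ''c'' [] else 0)
     else 0)"
            and o4: "agree_off (nat_writes edge_weights) (real_writes edge_weights) (N3, R3) s4"
          have d4: "fst s4 ''d'' = N3 ''d''" using o4 by (simp add: agree_off_def)
          have "fst s4 ''w'' [i, k] =
              edge_weight (Suc n) (touched n X Z) (feasibility_graph n v Z) (i, k)" if "i < n" "k < n" for i k
          proof -
            have "(i, k) \<in> feasibility_graph n v Z \<longleftrightarrow>
                R3 ''q'' [i, N3 ''d'' [i]] \<le> R3 ''s'' [i, k] \<and> (i \<noteq> k \<longrightarrow> R3 ''s'' [i, i] < R3 ''s'' [i, k])"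
              using that by (simp add: feasibility_graph_def feas) (simp add: e3 val)
            then show ?thesis using q4 that t[OF that(2)]
              unfolding edge_weight_def e3 c fst_conv snd_conv by (simp del: mult_Suc mult_Suc_right) blast
          qed
          then show "?Q s4" using dem by (simp add: d4)
        qed (use N nH in \<open>simp_all add: e3\<close>)
      qed (use N nH n_pos in \<open>simp_all add: e2\<close>)
    qed (use N nH in \<open>simp_all add: e1\<close>)
  qed
qed

definition finished :: "(nat \<Rightarrow> 'a set) \<Rightarrow> bool" where
  "finished Z \<longleftrightarrow> (\<exists>M. selectable n v X Z M \<and> card M = n)"

text \<open>The auction result is a selectable matching, so whatever the program removes is a legal
  choice of \<open>alg_step\<close>; when it finds no unmatched agent, that same matching shows that
  the algorithm may stop.\<close>

lemma runs_remove_if_unmatched: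
  assumes enc: "encodes n v X gs Z s" and safe: "safe Z"
    and dem: "\<forall>i<n. robust_demand n v Z i (fst s ''d'' [i])"
    and w: "\<forall>i<n. \<forall>k<n. fst s ''w'' [i, k] =
      edge_weight (Suc n) (touched n X Z) (feasibility_graph n v Z) (i, k)"
    and inv: "auction_inv n (\<lambda>i j. fst s ''w'' [i, j]) {..<n} (\<lambda>j. fst s ''p'' [j]) (\<lambda>j. fst s ''o'' [j])"
  shows "runs H remove_if_unmatched s (\<lambda>s'. encodes n v X gs Z s' \<and> finished Z \<or>
    (\<exists>Z'. alg_step n v X Z Z' \<and> encodes n v X gs Z' s'))"
    (is "runs H _ s ?Q")
proof -
  obtain N R where s: "s = (N, R)" by (cases s)
  let ?G = "feasibility_graph n v Z"
  have N: "N ''n'' [] = n" "N ''m'' [] = length gs"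
    and v: "\<And>i g. i < n \<Longrightarrow> g < length gs \<Longrightarrow> R ''v'' [i, g] = v i (gs ! g)"
    and x: "\<And>j g. j < n \<Longrightarrow> g < length gs \<Longrightarrow> N ''x'' [j, g] \<noteq> 0 \<longleftrightarrow> gs ! g \<in> Z j"
    and t: "\<And>j. j < n \<Longrightarrow> N ''t'' [j] \<noteq> 0 \<longleftrightarrow> j \<in> touched n X Z"
    using enc by (auto simp: encodes_def s)
  have nH: "n \<le> H" "length gs \<le> H" using H by auto
  define own where "own j = N ''o'' [j]" for j
  define W where "W i j = N ''w'' [i, j]" for i j
  define M where "M = {(own j - 1, j) | j. j < n \<and> 0 < W (own j - 1) j}"
  have inv': "auction_inv n W {..<n} (\<lambda>j. N ''p'' [j]) own"
    using inv by (simp add: s W_def[abs_def] own_def[abs_def])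
  have nz: "\<forall>j<n. own j \<noteq> 0" and bij: "bij_betw (\<lambda>j. own j - 1) {..<n} {..<n}"
    using auction_bij[OF inv'] by auto
  obtain M0 where M0: "matching_a ?G (touched n X Z) M0" using safe by (auto simp: safe_def)
  have M: "selectable n v X Z M"
    unfolding selectable_def M_def
    by (rule auction_matching_c[OF feasibility_graph_subset _ _ M0 _ inv', where K = "Suc n"])
      (use w in \<open>auto simp: s W_def touched_def\<close>)
  then have MG: "matching ?G M"
    by (auto simp: selectable_def matching_c_def matching_b_def matching_a_def)
  show ?thesis
    unfolding remove_if_unmatched_def s
  proof (rule runs_Seq[OF runs_find_unmatched[where N = N and R = R and n = n]])
    fix s1 assume q1: "if fst s1 ''e'' [] = 0 then \<forall>j<n. N ''w'' [N ''o'' [j] - 1, j] \<noteq> 0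
        else \<exists>j<n. N ''w'' [N ''o'' [j] - 1, j] = 0 \<and> fst s1 ''e'' [] = N ''o'' [j]"
      and o1: "agree_off (nat_writes find_unmatched) (real_writes find_unmatched) (N, R) s1"
    obtain N1 R1 where s1: "s1 = (N1, R1)" by (cases s1)
    have e1: "N1 ''m'' = N ''m''" "N1 ''x'' = N ''x''" "N1 ''t'' = N ''t''"
      "N1 ''d'' = N ''d''" "R1 ''v'' = R ''v''" "N1 ''n'' = N ''n''"
      using o1 by (auto simp: s1 agree_off_def)
    have enc1: "encodes n v X gs Z s1"
      by (rule encodes_agree_off[OF enc[unfolded s] o1]) auto
    show "runs H (Cond (nonzero (nvar ''e'')) remove_item Skip) s1 ?Q"
    proof (rule runs_Cond)
      assume "\<not> bval s1 (nonzero (nvar ''e''))"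
      then have "\<forall>j<n. W (own j - 1) j \<noteq> 0" using q1 unfolding W_def own_def by (simp add: s1)
      then have "M = (\<lambda>j. (own j - 1, j)) ` {..<n}" by (auto simp: M_def)
      then have "card M = n" by (simp add: card_image inj_on_def)
      then have "finished Z" using M by (auto simp: finished_def)
      then show "runs H Skip s1 ?Q" using enc1 by (intro runs_straight_line) simp_all
    next
      assume e: "bval s1 (nonzero (nvar ''e''))"
      then obtain j0 where j0: "j0 < n" "W (own j0 - 1) j0 = 0" "N1 ''e'' [] = own j0"
        using q1 unfolding W_def own_def by (auto simp: s1)
      define i where "i = own j0 - 1"
      have i: "i < n" "N1 ''e'' [] = Suc i"
        using bij_betwE[OF bij] j0 nz by (auto simp: i_def)
      \<comment> \<open>The assignment is bijective, so the pair with \<open>j0\<close>, discarded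
        for its weight 0, was the only chance for \<open>i\<close> to be matched.\<close>
      have iM: "i \<notin> fst ` M"
      proof
        assume "i \<in> fst ` M"
        then obtain j where j: "j < n" "own j - 1 = i" "0 < W (own j - 1) j" by (auto simp: M_def)
        then have "j = j0" using bij j0(1) unfolding bij_betw_def inj_on_def i_def by auto
        then show False using j j0 by simp
      qed
      have "card M \<noteq> n" using matching_finite(3)[OF MG] iM i(1) by auto
      define d where "d = N ''d'' [i]"
      have ch: "alg_choice n v X Z i d"
        unfolding alg_choice_def using M iM i(1) \<open>card M \<noteq> n\<close> dem by (auto simp: s d_def)
      have d: "d < n" using alg_choice_demand(2)[OF safe ch] .
      have Zd: "Z d \<subseteq> set gs" using safe_subset_items[OF safe d] gs(2) by simp
      obtain g where g: "g < length gs" "gs ! g \<in> Z d"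
        using alg_choice_nonempty[OF safe ch] Zd by (metis all_not_in_conv in_set_conv_nth subsetD)
      show "runs H remove_item s1 ?Q"
        unfolding s1
      proof (rule runs_weaken[OF runs_remove_item[where N = N1 and R = R1 and e = i and j = d and m = "length gs"]])
        show "\<exists>g<length gs. N1 ''x'' [d, g] \<noteq> 0" using g x[OF d] by (auto simp: e1)
      next
        fix s' assume "\<exists>z<length gs. N1 ''x'' [d, z] \<noteq> 0 \<and>
          (\<forall>g<length gs. N1 ''x'' [d, g] \<noteq> 0 \<longrightarrow> R1 ''v'' [i, z] \<le> R1 ''v'' [i, g]) \<and>
          fst s' ''x'' = (N1 ''x'')([d, z] := 0) \<and> fst s' ''t'' = (N1 ''t'')([d] := 1)"
          and o': "agree_off (nat_writes remove_item) (real_writes remove_item) (N1, R1) s'"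
        then obtain z where z: "z < length gs" "gs ! z \<in> Z d"
          and min: "\<forall>g<length gs. gs ! g \<in> Z d \<longrightarrow> v i (gs ! z) \<le> v i (gs ! g)"
          and s': "fst s' ''x'' = (N ''x'')([d, z] := 0)" "fst s' ''t'' = (N ''t'')([d] := 1)"
          using x[OF d] v[OF i(1)] by (auto simp: e1)
        define Z' where "Z' = Z(d := Z d - {gs ! z})"
        have "\<forall>b\<in>Z d. v i (gs ! z) \<le> v i b"
          using min Zd by (metis in_set_conv_nth subsetD)
        then have step: "alg_step n v X Z Z'"
          unfolding alg_step_def Z'_def using ch z(2) by blast
        have e': "fst s' ''n'' [] = n" "fst s' ''m'' [] = length gs" "snd s' ''v'' = R ''v''"
          using o' N by (auto simp: agree_off_def e1)
        have "touched n X Z' = insert d (touched n X Z)"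
          using d z(2) safe_subset[OF safe d] by (auto simp: touched_def Z'_def)
        moreover have "fst s' ''x'' [j, g] \<noteq> 0 \<longleftrightarrow> gs ! g \<in> Z' j" if "j < n" "g < length gs" for j g
          using x[OF that] nth_eq_iff_index_eq[OF gs(1) that(2) z(1)] by (auto simp: s' Z'_def)
        ultimately have "encodes n v X gs Z' s'"
          unfolding encodes_def using e' v t by (auto simp: s')
        then show "?Q s'" using step by blast
      qed (use i nH N in \<open>simp_all add: e1 d_def\<close>)
    qed
  qed (use N nH nz in \<open>simp_all add: own_def\<close>)
qed

lemma runs_algorithm_round:
  assumes enc: "encodes n v X gs Z s" and safe: "safe Z" and con: "constants (fst s)"
  shows "runs H algorithm_round s (\<lambda>s'. encodes n v X gs Z s' \<and> finished Z \<or>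
    (\<exists>Z'. alg_step n v X Z Z' \<and> encodes n v X gs Z' s'))"
  unfolding algorithm_round_def
proof (rule runs_Seq[OF runs_compute_weights[OF assms]], elim conjE)
  fix s1
  assume dem: "\<forall>i<n. robust_demand n v Z i (fst s1 ''d'' [i])"
    and w: "\<forall>i<n. \<forall>k<n. fst s1 ''w'' [i, k] =
      edge_weight (Suc n) (touched n X Z) (feasibility_graph n v Z) (i, k)"
    and o1: "agree_off (nat_writes compute_weights) (real_writes compute_weights) s s1"
  obtain N1 R1 where s1: "s1 = (N1, R1)" by (cases s1)
  have enc1: "encodes n v X gs Z s1" by (rule encodes_agree_off[OF enc o1]) auto
  show "runs H (Seq auction remove_if_unmatched) s1 (\<lambda>s'. encodes n v X gs Z s' \<and> finished Z \<or>
    (\<exists>Z'. alg_step n v X Z Z' \<and> encodes n v X gs Z' s'))"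
    unfolding s1
  proof (rule runs_Seq[OF runs_auction[where N = N1 and R = R1 and n = n and C = "max_weight (Suc n)"]])
    show "N1 ''n'' [] = n" using enc1 by (simp add: encodes_def s1)
    show "\<forall>i<n. \<forall>j<n. N1 ''w'' [i, j] \<le> max_weight (Suc n)"
    proof (intro allI impI)
      fix i j assume "i < n" "j < n"
      then have "N1 ''w'' [i, j] = edge_weight (Suc n) (touched n X Z) (feasibility_graph n v Z) (i, j)"
        using w by (simp add: s1)
      then show "N1 ''w'' [i, j] \<le> max_weight (Suc n)" by (simp only: edge_weight_le)
    qed
  next
    fix s2 assume inv: "auction_inv n (\<lambda>i j. N1 ''w'' [i, j]) {..<n} (\<lambda>j. fst s2 ''p'' [j]) (\<lambda>j. fst s2 ''o'' [j])"
      and o2: "agree_off (nat_writes auction) (real_writes auction) (N1, R1) s2"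
    have e2: "fst s2 ''w'' = N1 ''w''" "fst s2 ''d'' = N1 ''d''" using o2 by (auto simp: agree_off_def)
    show "runs H remove_if_unmatched s2 (\<lambda>s'. encodes n v X gs Z s' \<and> finished Z \<or>
    (\<exists>Z'. alg_step n v X Z Z' \<and> encodes n v X gs Z' s'))"
    proof (rule runs_remove_if_unmatched[OF _ safe])
      show "encodes n v X gs Z s2" by (rule encodes_agree_off[OF enc1[unfolded s1] o2]) auto
    qed (use dem w inv in \<open>simp_all add: e2 s1\<close>)
  qed (use H in simp_all)
qed

text \<open>Used in the main loop: if a round performs a step, the algorithm had not finished
  before, so the number of steps is still exactly the number of rounds.\<close>

lemma finished_no_step:
  assumes "finished Z"
  shows "\<not> alg_step n v X Z Z'"
proof
  assume "alg_step n v X Z Z'"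
  then obtain M where "selectable n v X Z M" "card M \<noteq> n"
    by (auto simp: alg_step_def alg_choice_def)
  moreover obtain M' where "selectable n v X Z M'" "card M' = n"
    using assms by (auto simp: finished_def)
  ultimately show False using matching_c_card_eq unfolding selectable_def by blast
qed

lemma runs_main_program:
  "runs H main_program (input_state n v X gs) (\<lambda>s'. alg_output n v X (output_family gs s'))"
  unfolding main_program_def
proof -
  let ?s = "input_state n v X gs"
  let ?Q = "\<lambda>s'. alg_output n v X (output_family gs s')"
  obtain N R where s: "?s = (N, R)" by (cases ?s)
  have enc: "encodes n v X gs X (N, R)" using encodes_input[of n v X gs] by (simp only: s)
  have Nn: "N ''n'' [] = n" using enc by (simp add: encodes_def)
  show "runs H (Seq weight_constants (Seq (NAssign ''h'' [] (NAdd (nvar ''m'') (NConst 1)))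
      (Seq (For ''r'' ''h'' algorithm_round) copy_output))) ?s ?Q"
    unfolding s
  proof (rule runs_Seq[OF runs_weight_constants[where N = N and R = R and n = n, OF Nn H(1)]])
    fix s1 assume c1: "fst s1 ''a'' [] = Suc n \<and> fst s1 ''b'' [] = Suc n * Suc n \<and>
        fst s1 ''c'' [] = Suc n * (Suc n * Suc n)"
      and o1: "agree_off (nat_writes weight_constants) (real_writes weight_constants) (N, R) s1"
    have enc1: "encodes n v X gs X s1" by (rule encodes_agree_off[OF enc o1]) auto
    define s2 where "s2 = nupdate ''h'' [] (NAdd (nvar ''m'') (NConst 1)) s1"
    have o2: "agree_off {''h''} {} s1 s2" by (simp add: s2_def agree_off_def nupdate_def)
    have enc2: "encodes n v X gs X s2" by (rule encodes_agree_off[OF enc1 o2]) auto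
    have h2: "fst s2 ''h'' [] = Suc (length gs)"
      using enc1 by (cases s1) (simp add: s2_def encodes_def)
    have con2: "constants (fst s2)" using c1 o2 by (simp add: constants_def agree_off_def)
    \<comment> \<open>After \<open>k\<close> rounds the algorithm has either performed exactly
      \<open>k\<close> steps or reached a family at which it stops.\<close>
    let ?I = "\<lambda>k N R. \<exists>Z. encodes n v X gs Z (N, R) \<and>
      ((alg_step n v X ^^ k) X Z \<or> (alg_step n v X)\<^sup>*\<^sup>* X Z \<and> finished Z)"
    show "runs H (Seq (NAssign ''h'' [] (NAdd (nvar ''m'') (NConst 1)))
        (Seq (For ''r'' ''h'' algorithm_round) copy_output)) s1 ?Q"
    proof (rule runs_Seq_straight_line)
      show "runs H (Seq (For ''r'' ''h'' algorithm_round) copy_output)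
          (result (NAssign ''h'' [] (NAdd (nvar ''m'') (NConst 1))) s1) ?Q"
        unfolding result.simps s2_def[symmetric]
      proof (rule runs_Seq[OF runs_For[where h = "Suc (length gs)" and I = ?I
              and Q = "\<lambda>s'. ?I (Suc (length gs)) (fst s') (snd s')"]])
        show "?I 0 (fst s2) (snd s2)" using enc2 by auto
        show "fst s2 ''h'' [] = Suc (length gs)" by (rule h2)
        show "?I k (N(''r'' := a)) R" if "?I k N R" for k N R a
          using that by (simp add: encodes_def)
      next
        fix k and N :: nstore and R :: rstore
        assume o3: "agree_off (insert ''r'' (nat_writes algorithm_round)) (real_writes algorithm_round) s2 (N, R)"
          and "?I k N R"
        then obtain Z where Z: "encodes n v X gs Z (N, R)"
          "(alg_step n v X ^^ k) X Z \<or> (alg_step n v X)\<^sup>*\<^sup>* X Z \<and> finished Z" by blast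
        then have steps: "(alg_step n v X)\<^sup>*\<^sup>* X Z" using relpowp_imp_rtranclp by metis
        have con: "constants (fst (N, R))" using con2 o3 by (simp add: constants_def agree_off_def)
        show "runs H algorithm_round (N, R) (\<lambda>s'. ?I (Suc k) (fst s') (snd s'))"
        proof (rule runs_weaken[OF runs_algorithm_round[OF Z(1) safe_steps[OF steps] con]])
          fix s' assume "encodes n v X gs Z s' \<and> finished Z \<or> (\<exists>Z'. alg_step n v X Z Z' \<and> encodes n v X gs Z' s')"
          then show "?I (Suc k) (fst s') (snd s')"
          proof (elim disjE conjE exE)
            assume "encodes n v X gs Z s'" "finished Z"
            then show ?thesis using steps by auto
          next
            fix Z' assume Z': "alg_step n v X Z Z'" "encodes n v X gs Z' s'"
            then have "(alg_step n v X ^^ k) X Z" using Z(2) finished_no_step by blast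
            then have "(alg_step n v X ^^ Suc k) X Z'" using relpowp_Suc_I Z'(1) by metis
            then show ?thesis using Z'(2) by (metis prod.collapse)
          qed
        qed
      next
        fix s3 assume I: "?I (Suc (length gs)) (fst s3) (snd s3)"
        obtain N3 R3 where s3: "s3 = (N3, R3)" by (cases s3)
        \<comment> \<open>By \<open>alg_steps_bound\<close>, \<open>card \<M> + 1\<close> steps are
          impossible, so after all rounds the second alternative of the invariant holds.\<close>
        have "length gs = card \<M>" using gs distinct_card by metis
        then obtain Z where Z: "encodes n v X gs Z (N3, R3)" "(alg_step n v X)\<^sup>*\<^sup>* X Z" "finished Z"
          using I alg_steps_bound[of "Suc (length gs)"] by (auto simp: s3)
        then obtain M where M: "selectable n v X Z M" "card M = n" by (auto simp: finished_def)
        have safe: "safe Z" using safe_steps[OF Z(2)] .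
        have e3: "N3 ''n'' [] = n" "N3 ''m'' [] = length gs" using Z(1) by (auto simp: encodes_def)
        show "runs H copy_output s3 ?Q"
          unfolding s3
        proof (rule runs_weaken[OF runs_copy_output[where N = N3 and R = R3, OF e3(1) _ e3(2)]])
          fix s' :: state assume y: "\<forall>i<n. \<forall>g<length gs. fst s' ''y'' [i, g] = N3 ''x'' [i, g]"
          have "output_family gs s' i = Z i" if "i < n" for i
          proof -
            have "Z i \<subseteq> set gs" using safe_subset_items[OF safe that] gs(2) by simp
            moreover have "output_family gs s' i = {gs ! g | g. g < length gs \<and> gs ! g \<in> Z i}"
              using y that Z(1) by (auto simp: output_family_def encodes_def)
            ultimately show ?thesis by (auto simp: in_set_conv_nth subset_iff)
          qed
          \<comment> \<open>As a selectable perfect matching is the identity, copying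
            \<open>x\<close> without consulting the matching yields a legal output.\<close>
          then have "\<forall>(i, j)\<in>M. output_family gs s' i = Z j"
            unfolding selectable_perfect[OF safe M] by auto
          then show "?Q s'" unfolding alg_output_def using Z(2) M by blast
        qed (use H in auto)
      qed (use H in auto)
    qed simp
  qed
qed

end

context nw_optimal
begin

lemma alg_steps_not_stuck:
  assumes "(alg_step n v X)\<^sup>*\<^sup>* X Z"
  shows "alg_not_stuck n v X Z"
proof -
  have safe: "safe Z" using safe_steps[OF assms] .
  obtain M where "matching_a (feasibility_graph n v Z) (touched n X Z) M"
    using safe by (auto simp: safe_def)
  then have "\<exists>M. selectable n v X Z M"
    unfolding selectable_def
    by (intro matching_c_exists[OF feasibility_graph_subset]) (auto simp: touched_def)
  then show ?thesis using alg_choice_nonempty[OF safe] by (auto simp: alg_not_stuck_def)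
qed

end

text \<open>For \<open>K = n + 1\<close>, the expansion of \<open>(K + 1) ^ 3\<close> dominates
  \<open>1 + K + K^2 + K^3\<close> term by term.\<close>

lemma auction_iterations_bound: "n * (max_weight (Suc n) + 1) \<le> (n + m + 2) ^ 4"
proof -
  have "max_weight (Suc n) + 1 \<le> (n + 2) ^ 3"
    by (simp add: power3_eq_cube algebra_simps)
  then have "n * (max_weight (Suc n) + 1) \<le> (n + m + 2) * (n + m + 2) ^ 3"
    by (intro mult_mono order_trans[OF _ power_mono[of "n + 2" "n + m + 2" 3]]) auto
  also have "\<dots> = (n + m + 2) ^ 4" by (simp add: power_Suc[symmetric] numeral_eq_Suc)
  finally show ?thesis .
qed

theorem theorem2:
  shows "\<exists>(c :: com) (p :: nat poly).
    \<forall>(n :: nat) (\<M> :: 'a set) (v :: nat \<Rightarrow> 'a \<Rightarrow> real) (X :: nat \<Rightarrow> 'a set).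
      0 < n \<longrightarrow> finite \<M> \<longrightarrow> (\<forall>i<n. \<forall>g\<in>\<M>. 0 < v i g) \<longrightarrow>
      allocation n \<M> X \<longrightarrow> NW n v X = opt n v \<M> \<longrightarrow>
        (\<forall>k Z. (alg_step n v X ^^ k) X Z \<longrightarrow> k \<le> card \<M> \<and> alg_not_stuck n v X Z) \<and>
        (\<forall>gs. distinct gs \<and> set gs = \<M> \<longrightarrow>
           (\<exists>t s. exec c (input_state n v X gs) t s \<and> t \<le> poly p (n + card \<M>) \<and>
                  alg_output n v X (output_family gs s))) \<and>
        (\<forall>Y. alg_output n v X Y \<longrightarrow>
           allocation n (\<Union>i<n. Y i) Y \<and>
           efficient n v \<M> (2 powr (1 - 1 / real n)) Y \<and>
           EFX n v Y \<and>
           (0 < opt n v \<M> \<longrightarrow> pareto_optimal n v (\<Union>i<n. Y i) Y) \<and>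
           (\<forall>i<n. Y i \<subseteq> X i))"
proof (intro exI[of _ main_program] exI[of _ "pcompose (cost_poly main_program) ([:2, 1:] ^ 4)"]
    allI impI)
  fix n :: nat and \<M> :: "'a set" and v :: "nat \<Rightarrow> 'a \<Rightarrow> real" and X :: "nat \<Rightarrow> 'a set"
  assume "0 < n" "finite \<M>" "\<forall>i<n. \<forall>g\<in>\<M>. 0 < v i g" "allocation n \<M> X" "NW n v X = opt n v \<M>"
  then interpret nw_optimal n \<M> v X by unfold_locales
  have "k \<le> card \<M> \<and> alg_not_stuck n v X Z" if "(alg_step n v X ^^ k) X Z" for k Z
    using alg_steps_bound[OF that] alg_steps_not_stuck[OF relpowp_imp_rtranclp[OF that]] by blast
  moreover have "\<exists>t s. exec main_program (input_state n v X gs) t s \<and>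
      t \<le> poly (pcompose (cost_poly main_program) ([:2, 1:] ^ 4)) (n + card \<M>) \<and>
      alg_output n v X (output_family gs s)" if gs: "distinct gs" "set gs = \<M>" for gs
  proof -
    \<comment> \<open>This is the value of \<open>[:2, 1:] ^ 4\<close> at
      \<open>n + card \<M>\<close>, so composing the cost polynomial with it evaluates to the cost
      for this \<open>H\<close>.\<close>
    define H where "H = (n + card \<M> + 2) ^ 4"
    have "n + card \<M> + 2 \<le> H"
      unfolding H_def by (rule self_le_power) auto
    moreover have "length gs = card \<M>" using gs distinct_card by metis
    ultimately interpret encoded_nw_optimal n \<M> v X gs H
      using gs auction_iterations_bound[of n "card \<M>"] by unfold_locales (auto simp: H_def)
    have "poly (pcompose (cost_poly main_program) ([:2, 1:] ^ 4)) (n + card \<M>) = cost H main_program"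
      by (simp add: poly_pcompose poly_cost_poly H_def algebra_simps)
    then show ?thesis using runs_main_program by (simp only: runs_def)
  qed
  ultimately show "(\<forall>k Z. (alg_step n v X ^^ k) X Z \<longrightarrow> k \<le> card \<M> \<and> alg_not_stuck n v X Z) \<and>
        (\<forall>gs. distinct gs \<and> set gs = \<M> \<longrightarrow>
           (\<exists>t s. exec main_program (input_state n v X gs) t s \<and>
              t \<le> poly (pcompose (cost_poly main_program) ([:2, 1:] ^ 4)) (n + card \<M>) \<and>
              alg_output n v X (output_family gs s))) \<and>
        (\<forall>Y. alg_output n v X Y \<longrightarrow>
           allocation n (\<Union>i<n. Y i) Y \<and>
           efficient n v \<M> (2 powr (1 - 1 / real n)) Y \<and>
           EFX n v Y \<and>
           (0 < opt n v \<M> \<longrightarrow> pareto_optimal n v (\<Union>i<n. Y i) Y) \<and>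
           (\<forall>i<n. Y i \<subseteq> X i))"
    using alg_output_properties by blast
qed

end
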